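(* Suppose that $r,n,e\in\mathbb{N}$ satisfy $n\ge r\ge 3$ and $e\le\binom{n}{2}$. Then $$\min\Big\{N(K_r,G)\colon G\in\mathcal{K}(n,e)\Big\}=h_r^{\ast}(n,e).$$ Moreover, if $r\ge 4$ and $e>t_{r-1}(n)$, then $$\Big\{G\in\mathcal{K}(n,e)\colon N(K_r,G)=h_r^{\ast}(n,e)\Big\}=\mathcal{H}_1^{\ast}(n,e).$$
   Context: $\mathbb{N}=\{1,2,\dots\}$, $[k]=\{1,\dots,k\}$ and $\binom{X}{s}$ is the set of $s$-element subsets of $X$. Graphs are finite and simple; families of graphs are considered up to isomorphism. An $(n,e)$-graph is a graph with $n$ vertices and $e$ edges. $N(K_r,G)$ is the number of $r$-cliques (complete subgraphs on $r$ vertices) in $G$. $T_s(n)$ is the balanced complete $s$-partite graph on $n$ vertices (part sizes differ by at most one; $T_1(n)$ has no edges) and $t_s(n)$ is its number of edges. $K[A_1,\dots,A_\ell]$ denotes the complete $\ell$-partite graph with parts $A_1,\dots,A_\ell$. $\mathcal{K}(n,e)$ is the family of all $(n,e)$-graphs that can be obtained from a complete multipartite graph (with any number $\ell\ge 1$ of parts) by adding a (possibly empty) triangle-free graph into one part. Given $n,e\in\mathbb{N}$ with $e\le\binom{n}{2}$, let $k=k(n,e):=\min\{s\in\mathbb{N}\colon t_s(n)\ge e\}$. Let $\bm{a}^{\ast}=(a_1^{\ast},\dots,a_k^{\ast})\in\mathbb{N}^k$ be the unique vector such that $$a_k^{\ast}=\min\{a\in\mathbb{N}\colon a(n-a)+t_{k-1}(n-a)\ge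 e\},$$ $a_1^{\ast}+\dots+a_{k-1}^{\ast}=n-a_k^{\ast}$ and $a_1^{\ast}\ge\dots\ge a_{k-1}^{\ast}\ge a_1^{\ast}-1$. Let $$m^{\ast}:=\sum_{\{i,j\}\in\binom{[k]}{2}}a_i^{\ast}a_j^{\ast}-e,\qquad h_r^{\ast}(n,e):=\sum_{I\in\binom{[k]}{r}}\prod_{i\in I}a_i^{\ast}-m^{\ast}\sum_{I'\in\binom{[k-2]}{r-2}}\prod_{j\in I'}a_j^{\ast}.$$ (One has $m^{\ast}\ge 0$.) Let $T:=K[A_1^{\ast},\dots,A_k^{\ast}]$ where $|A_i^{\ast}|=a_i^{\ast}$ for $i\in[k]$. The family $\mathcal{H}_1^{\ast}(n,e)$ is defined as follows. If $m^{\ast}=0$, take all graphs obtained from $T$ by replacing, for some $i\in[k-1]$, the bipartite graph $T[A_i^{\ast}\cup A_k^{\ast}]$ with an arbitrary triangle-free graph on $A_i^{\ast}\cup A_k^{\ast}$ with $a_i^{\ast}a_k^{\ast}$ edges. If $m^{\ast}>0$, take all graphs obtained from $T$ by replacing $T[A_{k-1}^{\ast}\cup A_k^{\ast}]$ with an arbitrary triangle-free graph on $A_{k-1}^{\ast}\cup A_k^{\ast}$ with $a_{k-1}^{\ast}a_k^{\ast}-m^{\ast}$ edges. *)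

theory Defs
  imports Complex_Main "HOL-Library.Ramsey" "HOL-Library.Disjoint_Sets"
begin

text \<open>
  A finite simple graph is a pair of a finite vertex set and a set of two-element subsets of it.
  Families of graphs are represented by sets of labelled graphs closed under renaming of vertices:
  each family below lets the vertex set range over all finite subsets of the vertex type, so that
  for an infinite vertex type two families are equal as sets iff they are equal up to isomorphism.
\<close>

type_synonym 'a graph = "'a set \<times> 'a set set"

definition verts :: "'a graph \<Rightarrow> 'a set" where
  "verts G = fst G"

definition edges :: "'a graph \<Rightarrow> 'a set set" where
  "edges G = snd G"

definition fin_graph :: "'a graph \<Rightarrow> bool" where
  "fin_graph G \<longleftrightarrow> finite (verts G) \<and> edges G \<subseteq> [verts G]\<^bsup>2\<^esup>"

definition ne_graph :: "nat \<Rightarrow> nat \<Rightarrow> 'a graph \<Rightarrow> bool" where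
  "ne_graph n e G \<longleftrightarrow> fin_graph G \<and> card (verts G) = n \<and> card (edges G) = e"

definition num_cliques :: "nat \<Rightarrow> 'a graph \<Rightarrow> nat" where
  "num_cliques r G = card {S \<in> [verts G]\<^bsup>r\<^esup>. clique S (edges G)}"

definition triangle_free :: "'a graph \<Rightarrow> bool" where
  "triangle_free G \<longleftrightarrow> \<not> (\<exists>S \<in> [verts G]\<^bsup>3\<^esup>. clique S (edges G))"

definition disjoint_parts :: "nat \<Rightarrow> (nat \<Rightarrow> 'a set) \<Rightarrow> bool" where
  "disjoint_parts l A \<longleftrightarrow> (\<forall>i\<in>{1..l}. finite (A i)) \<and> disjoint_family_on A {1..l}"

definition multipartite :: "nat \<Rightarrow> (nat \<Rightarrow> 'a set) \<Rightarrow> 'a graph" where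
  "multipartite l A =
     (\<Union>i\<in>{1..l}. A i,
      {{x, y} | x y. \<exists>i\<in>{1..l}. \<exists>j\<in>{1..l}. i \<noteq> j \<and> x \<in> A i \<and> y \<in> A j})"

text \<open>
  A concrete copy of the balanced complete \<open>s\<close>-partite graph on \<open>n\<close> vertices: its parts are the
  residue classes modulo \<open>s\<close> (those beyond the \<open>n\<close>-th are empty if \<open>s > n\<close>).
\<close>

definition turan_graph :: "nat \<Rightarrow> nat \<Rightarrow> nat graph" where
  "turan_graph s n = multipartite s (\<lambda>i. {x. x < n \<and> x mod s = i - 1})"

definition turan_num :: "nat \<Rightarrow> nat \<Rightarrow> nat" where
  "turan_num s n = card (edges (turan_graph s n))"

definition K_family :: "nat \<Rightarrow> nat \<Rightarrow> 'a graph set" where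
  "K_family n e =
     {G. ne_graph n e G \<and>
         (\<exists>l A i F. 1 \<le> l \<and> disjoint_parts l A \<and> (\<forall>j\<in>{1..l}. A j \<noteq> {}) \<and> i \<in> {1..l} \<and>
            fin_graph (A i, F) \<and> triangle_free (A i, F) \<and>
            verts G = verts (multipartite l A) \<and>
            edges G = edges (multipartite l A) \<union> F)}"

definition k_opt :: "nat \<Rightarrow> nat \<Rightarrow> nat" where
  "k_opt n e = (LEAST s. 1 \<le> s \<and> e \<le> turan_num s n)"

definition last_part :: "nat \<Rightarrow> nat \<Rightarrow> nat" where
  "last_part n e =
     (LEAST a. 1 \<le> a \<and> a \<le> n \<and> e \<le> a * (n - a) + turan_num (k_opt n e - 1) (n - a))"

text \<open>
  Vectors indexed by \<open>1, \<dots>, k\<close> are functions on \<open>nat\<close>; setting them to \<open>0\<close> outside that range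
  makes the vector below unique (for \<open>1 \<le> e \<le> n choose 2\<close>, which forces \<open>k \<ge> 2\<close>).
\<close>

definition a_star :: "nat \<Rightarrow> nat \<Rightarrow> nat \<Rightarrow> nat" where
  "a_star n e =
     (let k = k_opt n e in
      THE a. (\<forall>i\<in>{1..k}. 1 \<le> a i) \<and> (\<forall>i. i \<notin> {1..k} \<longrightarrow> a i = 0) \<and>
             a k = last_part n e \<and>
             (\<Sum>i\<in>{1..k-1}. a i) = n - a k \<and>
             (\<forall>i\<in>{1..k-1}. \<forall>j\<in>{1..k-1}. i \<le> j \<longrightarrow> a j \<le> a i) \<and>
             int (a (k-1)) \<ge> int (a 1) - 1)"

definition sum_prods :: "(nat \<Rightarrow> nat) \<Rightarrow> nat \<Rightarrow> nat \<Rightarrow> nat" where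
  "sum_prods a l s = (\<Sum>I\<in>[{1..l}]\<^bsup>s\<^esup>. \<Prod>i\<in>I. a i)"

definition m_star :: "nat \<Rightarrow> nat \<Rightarrow> int" where
  "m_star n e = int (sum_prods (a_star n e) (k_opt n e) 2) - int e"

definition h_star :: "nat \<Rightarrow> nat \<Rightarrow> nat \<Rightarrow> int" where
  "h_star r n e =
     int (sum_prods (a_star n e) (k_opt n e) r)
       - m_star n e * int (sum_prods (a_star n e) (k_opt n e - 2) (r - 2))"

text \<open>
  \<open>replace_induced T U F\<close> replaces the subgraph of \<open>T\<close> induced on the vertex subset \<open>U\<close> by the
  graph with vertex set \<open>U\<close> and edge set \<open>F\<close>.
\<close>

definition replace_induced :: "'a graph \<Rightarrow> 'a set \<Rightarrow> 'a set set \<Rightarrow> 'a graph" where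
  "replace_induced T U F = (verts T, (edges T - [U]\<^bsup>2\<^esup>) \<union> F)"

definition H1_star :: "nat \<Rightarrow> nat \<Rightarrow> 'a graph set" where
  "H1_star n e =
     (let k = k_opt n e; a = a_star n e; m = m_star n e in
      {G. \<exists>A i F. disjoint_parts k A \<and> (\<forall>j\<in>{1..k}. card (A j) = a j) \<and>
            i \<in> (if m = 0 then {1..k-1} else {k-1}) \<and>
            fin_graph (A i \<union> A k, F) \<and> triangle_free (A i \<union> A k, F) \<and>
            int (card F) = int (a i * a k) - m \<and>
            G = replace_induced (multipartite k A) (A i \<union> A k) F})"

end

theory Submission
  imports Defs "HOL-Library.Multiset" "HOL-Combinatorics.Permutations" "HOL-Computational_Algebra.Polynomial"
begin

text \<open>
  A graph in \<open>K(n, e)\<close> is given by the sizes of its independent parts and by the order \<open>b\<close> and size \<open>f\<close>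
  of the triangle-free graph in the remaining part, where \<open>4 f \<le> b\<^sup>2\<close> by Mantel's theorem; its clique
  counts are the coefficients of \<open>(1 + b t + f t\<^sup>2) \<Prod> (1 + a t)\<close> over the independent part sizes \<open>a\<close>.
  Trading one part \<open>a\<close> and \<open>(b, f)\<close> for \<open>(a', b', f')\<close> with the same \<open>a + b\<close> and \<open>a b + f\<close> preserves \<open>n\<close> and
  \<open>e\<close>, and moves all other clique counts in the direction of \<open>a f\<close>. If no such trade decreases \<open>a f\<close>, in
  any way of reading a complete multipartite graph as such a configuration, then all parts but the
  smallest differ by at most one and the missing edges are few enough that the configuration is the
  one built from \<open>a\<^sup>*\<close> and \<open>m\<^sup>*\<close>. A trade is strict for \<open>K\<^sub>r\<close> unless there is no \<open>K\<^sub>r\<close> at all, which gives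
  the extremal graphs; two large parts cannot be replaced by another triangle-free graph because of
  the uniqueness in Mantel's theorem.
\<close>

subsection \<open>Exchanging parts\<close>

text \<open>One independent part and the special part contribute
  \<open>1 + (a + b) t + (a b + f) t\<^sup>2 + a f t\<^sup>3\<close>. With order and size fixed only
  the cubic coefficient is free, and the other parts multiply its change by nonnegative numbers. So
  the triangle count can serve as the descent measure for all \<open>r\<close> simultaneously.

  The obstacle is that a trade sees a single independent part, while the target shape is global. If
  \<open>f\<close> is not of the form \<open>p * q\<close> with \<open>p + q = b\<close>, all trades
  must yield the same \<open>x\<close>, \<open>u\<close>, \<open>m\<close>, and the local conditions
  glue together. If it is of that form, the numbers do not tell which two parts were merged, and
  every pair has to be tried.

  The inequality \<open>x + m \<le> u\<close> is what minimality of \<open>x\<close> amounts to: one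
  vertex fewer in the smallest part would leave no room for all edges. The same minimality defines
  the last entry of \<open>a_star\<close>, which is how a local optimum meets the given formula.

  Numbers alone do not determine the special graph. Either it may be arbitrary, as in
  \<open>H1_star\<close>, or it has nearly equal sides and is forced to be complete
  bipartite.\<close>

text \<open>
  Among all \<open>(a', b', f')\<close> with the same \<open>a' + b'\<close> and \<open>a' * b' + f'\<close>, the product \<open>a' * f'\<close> is a cubic
  in \<open>a'\<close>. With \<open>x\<close> the least admissible value of \<open>a'\<close> and \<open>u \<le> v\<close> the halves of what remains, this
  cubic is minimal at \<open>a' = v\<close>. The alternatives for \<open>m = 0\<close> are the other ways of choosing one of
  the three parts \<open>x\<close>, \<open>u\<close>, \<open>v\<close> of a complete tripartite graph.
\<close>

lemma triple_descent:
  fixes a b f :: nat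
  assumes mantel: "4 * f \<le> b\<^sup>2" and pos: "0 < a * f"
  shows "(\<exists>a' b' f'. 4 * f' \<le> b'\<^sup>2 \<and> a' + b' = a + b \<and> a' * b' + f' = a * b + f \<and> a' * f' < a * f) \<or>
    (\<exists>x u v m. 1 \<le> x \<and> x + m \<le> u \<and> (v = u \<or> v = u + 1) \<and>
       (a = v \<and> b = x + u \<and> f + m = x * u \<or>
        m = 0 \<and> (a = u \<and> b = x + v \<and> f = x * v \<or> a = x \<and> b = u + v \<and> f = u * v)))"
    (is "?better \<or> ?tight")
proof (cases "4 * (a * b + f) \<le> (a + b)\<^sup>2")
  case True
  \<comment> \<open>The witness has \<open>a' = 0\<close>: a triangle-free part on all
    \<open>a + b\<close> vertices has room for every edge, and the new product is 0.\<close>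
  with pos show ?thesis
    by - (rule disjI1, rule exI[of _ 0], rule exI[of _ "a + b"], rule exI[of _ "a * b + f"], auto)
next
  case False
  define s where "s = a + b"
  define q where "q = a * b + f"
  \<comment> \<open>An independent part of size \<open>x\<close> leaves
    \<open>q - x * (s - x)\<close> edges for the other \<open>s - x\<close> vertices;
    \<open>fits\<close> is Mantel's bound for them, written without subtracting from
    \<open>q\<close>.\<close>
  define fits where "fits x \<longleftrightarrow> x \<le> s \<and> 4 * q \<le> 4 * x * (s - x) + (s - x)\<^sup>2" for x
  define x where "x = Least fits"
  have "fits a"
    using mantel by (simp add: s_def q_def fits_def)
  then have "fits x" and xa: "x \<le> a"
    unfolding x_def by (rule LeastI, rule Least_le)
  then have x: "x \<le> s" "4 * q \<le> 4 * x * (s - x) + (s - x)\<^sup>2"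
    by (simp_all add: fits_def)
  have "x \<noteq> 0"
  proof
    assume "x = 0"
    with x(2) False show False by (simp add: s_def q_def)
  qed
  then have x1: "1 \<le> x" by simp
  define u where "u = (s - x) div 2"
  define v where "v = s - x - u"
  have uv: "v = u \<or> v = u + 1" unfolding u_def v_def by linarith
  have sx: "s = x + u + v" using x(1) unfolding u_def v_def by linarith
  have "4 * q \<le> 4 * x * (u + v) + (u + v)\<^sup>2" using x(2) sx by simp
  then have "q \<le> x * (u + v) + u * v"
    using uv by (auto simp: power2_eq_square algebra_simps)
  \<comment> \<open>\<open>m\<close> is the number of edges missing from the complete tripartite
    graph with parts \<open>x\<close>, \<open>u\<close>, \<open>v\<close>.\<close>
  then obtain m where m: "q + m = x * (u + v) + u * v" using le_Suc_ex by metis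
  have "\<not> fits (x - 1)"
    using not_less_Least[of "x - 1" fits] x1 by (simp add: x_def)
  moreover obtain y where y: "x = Suc y" using x1 by (cases x) auto
  ultimately have "4 * y * (u + v + 1) + (u + v + 1)\<^sup>2 < 4 * q"
    using sx by (simp add: fits_def not_le)
  \<comment> \<open>The integer part of \<open>(u + v + 1)^2 / 4\<close> is
    \<open>(u + 1) * v\<close> for both possible values of \<open>v\<close>. Comparing with the
    definition of \<open>m\<close> turns the failure of \<open>x - 1\<close> into
    \<open>x + m \<le> u\<close>.\<close>
  then have "y * (u + v + 1) + (u + 1) * v < q"
    using uv by (auto simp: power2_eq_square algebra_simps)
  then have xm: "x + m \<le> u" using m y by (simp add: algebra_simps)
  have "m \<le> x * u"
    using xm x1 mult_le_mono1[of 1 x u] by linarith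
  then obtain f' where f': "f' + m = x * u" by (metis add.commute le_Suc_ex)
  have eqs: "a + b = x + u + v" "a * b + f + m = x * (u + v) + u * v"
    using m sx by (simp_all add: s_def q_def)
  have f_eq: "int f = int x * (u + v) + int u * v - m - a * (int x + u + v - a)"
  proof -
    have "int (a * b + f + m) = int (x * (u + v) + u * v)" "int b = int x + u + v - a"
      using eqs by linarith+
    then show ?thesis by (simp add: algebra_simps)
  qed
  have f'_eq: "int f' = int x * u - m"
    using f' by (metis add_diff_cancel_right' of_nat_add of_nat_mult)
  \<comment> \<open>The cubics \<open>t * (q - t * (s - t))\<close> and
    \<open>(t - x) * (t - u) * (t - v)\<close> differ by \<open>m * t\<close> and a constant; the
    identity subtracts their values at \<open>t = v\<close> from those at
    \<open>t = a\<close>.\<close>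
  have key: "int (a * f) - int (v * f')
      = (int a - u) * (int a - v) * (int a - x) - m * (int a - v)"
    unfolding of_nat_mult f_eq f'_eq by (simp add: algebra_simps)
  show ?thesis
  proof (cases "v * f' < a * f")
    case True
    have "4 * f' \<le> (x + u)\<^sup>2"
    proof -
      have "4 * (int x * u) \<le> (int x + u)\<^sup>2"
        using zero_le_power2[of "int x - u"] by (simp add: power2_eq_square algebra_simps)
      then have "int (4 * (x * u)) \<le> int ((x + u)\<^sup>2)" by simp
      then have "4 * (x * u) \<le> (x + u)\<^sup>2" by (simp only: of_nat_le_iff)
      with f' show ?thesis by linarith
    qed
    moreover have "v * (x + u) + f' = a * b + f"
      using f' eqs(2) by (simp add: algebra_simps)
    moreover have "v + (x + u) = a + b" using eqs(1) by simp
    ultimately have ?better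
      using True by blast
    then show ?thesis ..
  next
    case False
    then have le0: "(int a - u) * (int a - v) * (int a - x) - m * (int a - v) \<le> 0"
      using key by linarith
    \<comment> \<open>Above \<open>v\<close> the difference would be positive, since
      \<open>m \<le> u - x < a - x\<close>. Below \<open>v\<close> it is a sum of two nonnegative
      terms, so both vanish, which leaves \<open>m = 0\<close> and the roots \<open>u\<close> and
      \<open>x\<close>.\<close>
    have "a \<le> v"
    proof (rule ccontr)
      assume "\<not> a \<le> v"
      then have 1: "int a - v > 0" by simp
      have "int m < 1 * (int a - x)"
        using \<open>\<not> a \<le> v\<close> xm uv by auto
      also have "1 * (int a - x) \<le> (int a - u) * (int a - x)"
        using \<open>\<not> a \<le> v\<close> uv xa by (intro mult_right_mono) auto
      finally have "0 < (int a - v) * ((int a - u) * (int a - x) - m)"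
        using 1 by (intro mult_pos_pos) auto
      with le0 show False by (simp add: algebra_simps)
    qed
    show ?thesis
    proof (cases "a = v")
      case True
      have "b = x + u" using eqs(1) True by simp
      moreover have "f + m = x * u"
        using eqs(2) True calculation by (simp add: algebra_simps)
      ultimately have ?tight using True x1 xm uv
        by - (rule exI[of _ x], rule exI[of _ u], rule exI[of _ v], rule exI[of _ m], auto)
      then show ?thesis ..
    next
      case False
      then have au: "a \<le> u" "a < v" using \<open>a \<le> v\<close> uv by auto
      define g where "g = (int a - u) * (int a - v) * (int a - x)"
      have "0 \<le> g"
        unfolding g_def using au xa by (intro mult_nonneg_nonneg mult_nonpos_nonpos) auto
      moreover have "0 \<le> m * (int v - a)" using au by simp
      moreover have "g + m * (int v - a) \<le> 0"
        using le0 unfolding g_def by (simp add: algebra_simps)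
      ultimately have "g = 0" "m * (int v - a) = 0" by linarith+
      then have m0: "m = 0" and "a = u \<or> a = x" using False by (auto simp: g_def)
      then consider "a = u" | "a = x" by blast
      then have ?tight
      proof cases
        case 1
        have b: "b = x + v" using eqs(1) 1 by simp
        have "f = x * v" using eqs(2) b 1 m0 by (simp add: algebra_simps)
        with b 1 m0 show ?thesis using x1 xm uv
          by - (rule exI[of _ x], rule exI[of _ u], rule exI[of _ v], rule exI[of _ m], auto)
      next
        case 2
        have b: "b = u + v" using eqs(1) 2 by simp
        have "f = u * v" using eqs(2) b 2 m0 by (simp add: algebra_simps)
        with b 2 m0 show ?thesis using x1 xm uv
          by - (rule exI[of _ x], rule exI[of _ u], rule exI[of _ v], rule exI[of _ m], auto)
      qed
      then show ?thesis ..
    qed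
  qed
qed

section \<open>Generating polynomials of configurations\<close>

definition parts_poly :: "nat multiset \<Rightarrow> nat poly" where
  "parts_poly c = (\<Prod>a\<in>#c. [:1, a:])"

definition cfg_poly :: "nat multiset \<Rightarrow> nat \<Rightarrow> nat \<Rightarrow> nat poly" where
  "cfg_poly c b f = parts_poly c * [:1, b, f:]"

lemma smult_Suc_0 [simp]: "smult (Suc 0) p = p"
  by (simp flip: One_nat_def)

lemma parts_poly_empty [simp]: "parts_poly {#} = 1"
  by (simp add: parts_poly_def)

lemma parts_poly_add_mset [simp]: "parts_poly (add_mset a c) = [:1, a:] * parts_poly c"
  by (simp add: parts_poly_def)

lemma parts_poly_union [simp]: "parts_poly (c + d) = parts_poly c * parts_poly d"
  by (simp add: parts_poly_def)

text \<open>An empty part contributes the factor 1, so it can be added or dropped without affecting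
  any clique count.\<close>

lemma parts_poly_filter_pos: "parts_poly (filter_mset ((<) 0) c) = parts_poly c"
  by (induction c) (auto simp flip: one_pCons)

lemma coeff_parts_poly_0 [simp]: "coeff (parts_poly c) 0 = 1"
  by (induction c) (simp_all add: coeff_mult_0)

lemma coeff_parts_poly_1: "coeff (parts_poly c) (Suc 0) = sum_mset c"
  by (induction c) simp_all

lemma coeff_parts_poly_eq_0: "size c < n \<Longrightarrow> coeff (parts_poly c) n = 0"
proof (induction c arbitrary: n)
  case (add a c)
  then show ?case by (cases n) simp_all
qed (auto simp flip: one_pCons simp: coeff_pCons split: nat.splits)

lemma coeff_parts_poly_pos: "0 \<notin># c \<Longrightarrow> n \<le> size c \<Longrightarrow> 0 < coeff (parts_poly c) n"
proof (induction c arbitrary: n)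
  case (add a c)
  then show ?case by (cases n) simp_all
qed simp

lemma coeff_cfg_poly_0 [simp]: "coeff (cfg_poly c b f) 0 = 1"
  by (simp add: cfg_poly_def coeff_mult_0)

lemma coeff_cfg_poly_1: "coeff (cfg_poly c b f) (Suc 0) = sum_mset c + b"
  by (simp add: cfg_poly_def mult.commute[of "parts_poly c"] coeff_parts_poly_1)

lemma coeff_cfg_poly_add2:
  "coeff (cfg_poly c b f) (Suc (Suc n)) =
     coeff (parts_poly c) (Suc (Suc n)) + b * coeff (parts_poly c) (Suc n) + f * coeff (parts_poly c) n"
  by (simp add: cfg_poly_def mult.commute[of "parts_poly c"])

lemma coeff_cfg_poly_2: "coeff (cfg_poly c b f) 2 = coeff (parts_poly c) 2 + b * sum_mset c + f"
  by (simp add: numeral_2_eq_2 coeff_cfg_poly_add2 coeff_parts_poly_1)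

lemma cfg_poly_add_mset: "cfg_poly (add_mset a c) b f = parts_poly c * [:1, a + b, a * b + f, a * f:]"
proof -
  have "[:1, a:] * [:1, b, f:] = [:1, a + b, a * b + f, a * f:]" by simp
  then show ?thesis
    unfolding cfg_poly_def parts_poly_add_mset by (metis mult.assoc mult.commute)
qed

lemma cfg_poly_product: "cfg_poly c (p + q) (p * q) = parts_poly (c + {#p, q#})"
proof -
  have "parts_poly {#p, q#} = [:1, p + q, p * q:]" by simp
  then show ?thesis by (simp only: cfg_poly_def parts_poly_union)
qed

text \<open>Degrees 1 and 2 are order and size. Strictness at degree 3 makes descent terminate, and
  the last clause makes the step strict at every \<open>r\<close> where the old configuration has an
  \<open>r\<close>-clique, which is what characterises equality.\<close>

definition improves :: "nat poly \<Rightarrow> nat poly \<Rightarrow> bool" where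
  "improves P Q \<longleftrightarrow> coeff P 1 = coeff Q 1 \<and> coeff P 2 = coeff Q 2 \<and> coeff P 3 < coeff Q 3 \<and>
     (\<forall>r\<ge>3. coeff P r \<le> coeff Q r \<and> (coeff P r = coeff Q r \<longrightarrow> coeff Q r = 0))"

definition improvable :: "nat poly \<Rightarrow> bool" where
  "improvable Q \<longleftrightarrow> (\<exists>c b f. 0 \<notin># c \<and> 4 * f \<le> b\<^sup>2 \<and> improves (cfg_poly c b f) Q)"

text \<open>The coefficient at \<open>n + 3\<close> changes by \<open>q - p\<close> times the
  coefficient of \<open>parts_poly c\<close> at \<open>n\<close>. If the latter is 0 there are fewer
  than \<open>n\<close> parts, all of them nonempty, and the whole coefficient at
  \<open>n + 3\<close> vanishes.\<close>

lemma improves_cubic: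
  assumes c: "0 \<notin># c" and less: "p < q"
  shows "improves (parts_poly c * [:1, s, t, p:]) (parts_poly c * [:1, s, t, q:])"
proof -
  have coeff3: "coeff (parts_poly c * [:1, s, t, x:]) (Suc (Suc (Suc n))) =
      coeff (parts_poly c) (Suc (Suc (Suc n))) + s * coeff (parts_poly c) (Suc (Suc n))
      + t * coeff (parts_poly c) (Suc n) + x * coeff (parts_poly c) n" for x n
    by (simp add: mult.commute[of "parts_poly c"])
  have zero: "coeff (parts_poly c) (Suc (Suc (Suc n))) + s * coeff (parts_poly c) (Suc (Suc n))
      + t * coeff (parts_poly c) (Suc n) + q * coeff (parts_poly c) n = 0"
    if "coeff (parts_poly c) n = 0" for n
  proof -
    have "size c < n" using coeff_parts_poly_pos[OF c, of n] that by (cases "n \<le> size c") auto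
    then show ?thesis by (simp add: coeff_parts_poly_eq_0)
  qed
  have "coeff (parts_poly c * [:1, s, t, p:]) r \<le> coeff (parts_poly c * [:1, s, t, q:]) r \<and>
      (coeff (parts_poly c * [:1, s, t, p:]) r = coeff (parts_poly c * [:1, s, t, q:]) r \<longrightarrow>
       coeff (parts_poly c * [:1, s, t, q:]) r = 0)" if r3: "3 \<le> r" for r
  proof -
    obtain n where "r = 3 + n"
      using le_Suc_ex[OF r3] by blast
    then have r: "r = Suc (Suc (Suc n))" by simp
    show ?thesis
    proof (cases "coeff (parts_poly c) n = 0")
      case True
      show ?thesis unfolding r coeff3 zero[OF True] using True zero[OF True] by simp
    next
      case False
      with less show ?thesis unfolding r coeff3 by simp
    qed
  qed
  moreover have "coeff (parts_poly c * [:1, s, t, p:]) 3 < coeff (parts_poly c * [:1, s, t, q:]) 3"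
    unfolding numeral_3_eq_3 coeff3 using less by simp
  moreover have "coeff (parts_poly c * [:1, s, t, p:]) i = coeff (parts_poly c * [:1, s, t, q:]) i"
    if "i = 1 \<or> i = 2" for i
    using that by (auto simp: mult.commute[of "parts_poly c"] numeral_2_eq_2)
  ultimately show ?thesis unfolding improves_def by blast
qed

lemma improvable_or_tight:
  assumes c: "0 \<notin># add_mset a c" and f: "4 * f \<le> b\<^sup>2" "0 < f"
    and not_improvable: "\<not> improvable (cfg_poly (add_mset a c) b f)"
  shows "\<exists>x u v m. 1 \<le> x \<and> x + m \<le> u \<and> (v = u \<or> v = u + 1) \<and>
       (a = v \<and> b = x + u \<and> f + m = x * u \<or>
        m = 0 \<and> (a = u \<and> b = x + v \<and> f = x * v \<or> a = x \<and> b = u + v \<and> f = u * v))"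
proof -
  have pos: "0 < a * f" using c f by auto
  moreover have "\<not> (4 * f' \<le> b'\<^sup>2 \<and> a' + b' = a + b \<and> a' * b' + f' = a * b + f \<and> a' * f' < a * f)"
    for a' b' f'
  proof
    assume *: "4 * f' \<le> b'\<^sup>2 \<and> a' + b' = a + b \<and> a' * b' + f' = a * b + f \<and> a' * f' < a * f"
    \<comment> \<open>A trade may empty the independent part. It is then dropped to keep all parts
      nonempty; the polynomial keeps its form because \<open>a' * f' = 0\<close>.\<close>
    define c' where "c' = (if a' = 0 then c else add_mset a' c)"
    have "0 \<notin># c'" using c by (auto simp: c'_def)
    moreover have "cfg_poly c' b' f' = parts_poly c * [:1, a + b, a * b + f, a' * f':]"
      using * by (auto simp: c'_def cfg_poly_add_mset) (simp add: cfg_poly_def)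
    then have "improves (cfg_poly c' b' f') (cfg_poly (add_mset a c) b f)"
      unfolding cfg_poly_add_mset[of a] using * c improves_cubic[of c "a' * f'" "a * f"] by simp
    ultimately show False using * not_improvable unfolding improvable_def by blast
  qed
  ultimately show ?thesis using triple_descent[OF f(1) pos] by blast
qed

section \<open>Numerical shape of configurations that admit no improvement\<close>

lemma near_equal_factors_unique:
  fixes p q u v :: nat
  assumes "p + q = u + v" "p * q = u * v" "v \<le> u + 1" "u \<le> v"
  shows "q \<le> p + 1"
proof -
  have "(int q - p)\<^sup>2 = (int p + q)\<^sup>2 - 4 * (int p * q)"
    by (simp add: power2_eq_square algebra_simps)
  also have "\<dots> = (int u + v)\<^sup>2 - 4 * (int u * v)"
    using assms(1,2) by (metis of_nat_add of_nat_mult)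
  also have "\<dots> = (int v - u)\<^sup>2"
    by (simp add: power2_eq_square algebra_simps)
  finally have "int q - p = int v - u \<or> int q - p = - (int v - u)" by (simp add: power2_eq_iff)
  then show ?thesis using assms by linarith
qed

text \<open>Passing from \<open>x * u\<close> to \<open>y * v\<close> at fixed sum gains
  \<open>(y - x) * (v - x)\<close>, so \<open>l\<close> would be at least this large; but
  \<open>y + l \<le> v\<close> makes \<open>v - x\<close> exceed \<open>l\<close>. This lets
  different independent parts agree on one pair \<open>x\<close>, \<open>u\<close>.\<close>

lemma tight_split_unique:
  fixes x u y v :: nat
  assumes "x + u = y + v" "f + m = x * u" "f + l = y * v" "y + l \<le> v"
  shows "\<not> x < y"
proof
  assume "x < y"
  then obtain d where y: "y = x + 1 + d" by (metis add.assoc less_iff_Suc_add Suc_eq_plus1 add.commute)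
  with assms(1) have u: "u = v + 1 + d" by simp
  have "(1 + d) * v + m = (1 + d) * x + l"
    using assms(2,3) unfolding y u by (simp add: algebra_simps)
  moreover have "x + l + 1 \<le> v" using assms(4) y by simp
  then have "(1 + d) * (x + l + 1) \<le> (1 + d) * v" by (rule mult_le_mono2)
  ultimately show False by (simp add: algebra_simps)
qed

text \<open>Serves the case without independent parts, where there is nothing to trade. The least
  \<open>x\<close> with enough room exists because the middle split attains Mantel's bound, and
  failure of \<open>x - 1\<close> gives \<open>x + m \<le> u\<close>.\<close>

lemma tight_split_exists:
  fixes f b :: nat
  assumes "4 * f \<le> b\<^sup>2" "0 < f"
  shows "\<exists>x u m. 1 \<le> x \<and> x + m \<le> u \<and> b = u + x \<and> f + m = u * x"
proof -
  define x where "x = (LEAST x. f \<le> x * (b - x))"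
  have "f \<le> (b div 2) * (b - b div 2)"
  proof (cases "even b")
    case True
    then show ?thesis using assms by (auto elim!: evenE simp: power2_eq_square)
  next
    case False
    then obtain k where b: "b = 2 * k + 1" by (metis oddE)
    have "f \<le> k * (k + 1)" using assms(1) unfolding b by (simp add: power2_eq_square algebra_simps)
    then show ?thesis unfolding b by simp
  qed
  then have x: "f \<le> x * (b - x)" and "x \<le> b div 2"
    unfolding x_def by (rule LeastI, rule Least_le)
  have "x \<noteq> 0" using x(1) assms(2) by (metis mult_0 not_le)
  with \<open>x \<le> b div 2\<close> have x1: "1 \<le> x" "x \<le> b" by simp_all
  then obtain y where y: "x = Suc y" by (cases x) auto
  obtain u where b: "b = u + x" using x1 by (metis le_Suc_ex add.commute)
  obtain m where m: "f + m = u * x" using x b by (metis add_diff_cancel_right' le_Suc_ex mult.commute)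
  have "\<not> f \<le> y * (b - y)"
    using not_less_Least[of y "\<lambda>x. f \<le> x * (b - x)"] y by (simp add: x_def)
  then have "x + m \<le> u" using m unfolding b y by (simp add: algebra_simps)
  then show ?thesis using x1 b m by blast
qed

text \<open>
  The parts \<open>a\<^sub>1\<^sup>*, \<dots>, a\<^sub>k\<^sup>*\<close> are \<open>D\<close> together with \<open>u\<close> and \<open>x\<close>, where \<open>x\<close> is the last and \<open>u\<close> the
  next to last; \<open>x + m \<le> u\<close> expresses that \<open>x - 1\<close> would give too few edges.
\<close>

definition frame :: "nat multiset \<Rightarrow> nat \<Rightarrow> nat \<Rightarrow> nat \<Rightarrow> bool" where
  "frame D u x m \<longleftrightarrow> (\<forall>y\<in>#D. y = u \<or> y = u + 1) \<and> 1 \<le> x \<and> x + m \<le> u"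

text \<open>
  In the second case the graph is complete multipartite, and any two of its parts (possibly an empty
  one) may have been merged into the special part.
\<close>

definition canonical :: "nat multiset \<Rightarrow> nat \<Rightarrow> nat \<Rightarrow> nat multiset \<Rightarrow> nat \<Rightarrow> nat \<Rightarrow> nat \<Rightarrow> bool" where
  "canonical c b f D u x m \<longleftrightarrow> frame D u x m \<and>
     (c = D \<and> b = u + x \<and> f + m = u * x \<or>
      m = 0 \<and> (\<exists>p q. b = p + q \<and> f = p * q \<and> filter_mset ((<) 0) (c + {#p, q#}) = D + {#u, x#}))"

text \<open>Besides making the natural subtraction \<open>u * x - m\<close> exact, this leaves at
  least one edge in the special part, on which positivity of the minimum rests.\<close>

lemma frame_mult: "frame D u x m \<Longrightarrow> m < u * x"
proof -
  assume "frame D u x m"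
  then have "x + m \<le> u" "1 \<le> x" by (auto simp: frame_def)
  moreover from this(2) have "u * 1 \<le> u * x" by (rule mult_le_mono2)
  ultimately show ?thesis by linarith
qed

text \<open>Merging two parts into a complete bipartite graph does not affect the product of the
  factors, so all readings share their clique counts.\<close>

lemma canonical_poly:
  assumes "canonical c b f D u x m"
  shows "cfg_poly c b f = cfg_poly D (u + x) (u * x - m)"
  using assms unfolding canonical_def
proof (elim conjE disjE exE)
  assume "c = D" "b = u + x" "f + m = u * x"
  then show ?thesis by (metis add_diff_cancel_right')
next
  fix p q
  assume "m = 0" and pq: "b = p + q" "f = p * q" "filter_mset ((<) 0) (c + {#p, q#}) = D + {#u, x#}"
  have "cfg_poly c b f = parts_poly (filter_mset ((<) 0) (c + {#p, q#}))"
    unfolding pq(1,2) cfg_poly_product parts_poly_filter_pos ..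
  also have "\<dots> = cfg_poly D (u + x) (u * x - m)"
    unfolding pq(3) using \<open>m = 0\<close> by (simp only: diff_zero cfg_poly_product)
  finally show ?thesis .
qed

text \<open>With \<open>x\<close> and \<open>u\<close> the two smallest parts, any further part
  \<open>y\<close> is merged with \<open>u\<close> into the special part while \<open>x\<close> is
  kept as the independent part to trade. Each tight outcome forces \<open>y \<le> u + 1\<close>: two
  by comparing sums with the minimal \<open>x\<close>, the third because sum and product determine
  the difference of the factors.\<close>

lemma multipartite_canonical:
  assumes M: "0 \<notin># M" and edge: "coeff (parts_poly M) 2 \<noteq> 0" and "\<not> improvable (parts_poly M)"
  shows "\<exists>D u x. frame D u x 0 \<and> M = D + {#u, x#}"
proof -
  have "2 \<le> size M" using edge coeff_parts_poly_eq_0 by (metis not_le)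
  then have "M \<noteq> {#}" by auto
  define x where "x = Min_mset M"
  have "x \<in># M" using \<open>M \<noteq> {#}\<close> by (simp add: x_def)
  then obtain M1 where M1: "M = add_mset x M1" by (metis insert_DiffM)
  then have "M1 \<noteq> {#}" using \<open>2 \<le> size M\<close> by auto
  define u where "u = Min_mset M1"
  have "u \<in># M1" using \<open>M1 \<noteq> {#}\<close> by (simp add: u_def)
  then obtain D where D: "M1 = add_mset u D" by (metis insert_DiffM)
  have "u \<in># M" using D M1 by simp
  then have "x \<le> u" by (simp add: x_def)
  have "y = u \<or> y = u + 1" if y: "y \<in># D" for y
  proof -
    have "y \<in># M1" using D y by simp
    then have "u \<le> y" by (simp add: u_def)
    obtain D' where D': "D = add_mset y D'" using y by (metis insert_DiffM)
    have "M = add_mset x D' + {#u, y#}"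
      by (simp add: M1 D D')
    then have "\<not> improvable (cfg_poly (add_mset x D') (u + y) (u * y))"
      using assms(3) by (simp only: cfg_poly_product not_False_eq_True)
    moreover have "4 * (u * y) \<le> (u + y)\<^sup>2"
    proof -
      have "4 * (int u * y) \<le> (int u + y)\<^sup>2"
        using zero_le_power2[of "int u - y"] by (simp add: power2_eq_square algebra_simps)
      then have "int (4 * (u * y)) \<le> int ((u + y)\<^sup>2)" by simp
      then show ?thesis by (simp only: of_nat_le_iff)
    qed
    moreover have "0 \<notin># add_mset x D'" "0 < u * y" using M unfolding M1 D D' by auto
    ultimately obtain x' u' v' m' where
      t: "x' + m' \<le> u'" "v' = u' \<or> v' = u' + 1"
       "x = v' \<and> u + y = x' + u' \<or>
        x = u' \<and> u + y = x' + v' \<or> u + y = u' + v' \<and> u * y = u' * v'"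
      using improvable_or_tight[of x D' "u * y" "u + y"] by blast
    from t(3) have "y \<le> u + 1"
    proof (elim disjE conjE)
      assume "u + y = u' + v'" "u * y = u' * v'"
      with near_equal_factors_unique[of u y u' v'] t(2) show ?thesis by auto
    qed (use t \<open>x \<le> u\<close> \<open>u \<le> y\<close> in auto)
    with \<open>u \<le> y\<close> show ?thesis by auto
  qed
  moreover have "1 \<le> x" using M M1 by (cases x) auto
  ultimately have "frame D u x 0" using \<open>x \<le> u\<close> by (simp add: frame_def)
  moreover have "M = D + {#u, x#}" using M1 D by simp
  ultimately show ?thesis by blast
qed

lemma canonical_or_improvable:
  assumes c: "0 \<notin># c" and f: "4 * f \<le> b\<^sup>2"
    and edge: "coeff (cfg_poly c b f) 2 \<noteq> 0" and not_improvable: "\<not> improvable (cfg_poly c b f)"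
  shows "\<exists>D u x m. canonical c b f D u x m"
\<comment> \<open>The split is purely numerical: the special graph itself need not be bipartite.
  Since \<open>q = 0\<close> is allowed, the second case has \<open>f > 0\<close>, and there all
  tight outcomes with \<open>m = 0\<close> are excluded.\<close>
proof (cases "\<exists>p q. b = p + q \<and> f = p * q")
  case True
  then obtain p q where pq: "b = p + q" "f = p * q" by blast
  define M where "M = filter_mset ((<) 0) (c + {#p, q#})"
  have "parts_poly M = cfg_poly c b f"
    unfolding M_def parts_poly_filter_pos pq cfg_poly_product ..
  moreover have "0 \<notin># M" by (simp add: M_def)
  ultimately obtain D u x where "frame D u x 0" "M = D + {#u, x#}"
    using multipartite_canonical[of M] edge not_improvable by auto
  then have "canonical c b f D u x 0"
    unfolding canonical_def M_def using pq by blast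
  then show ?thesis by blast
next
  case False
  then have f0: "0 < f" by (metis add.right_neutral gr0I mult_0_right)
  have tight: "\<exists>x u m. 1 \<le> x \<and> x + m \<le> u \<and> b = x + u \<and> f + m = x * u \<and> (a = u \<or> a = u + 1)"
    if a: "a \<in># c" for a
  proof -
    obtain c' where "c = add_mset a c'" using a by (metis insert_DiffM)
    then show ?thesis
      using improvable_or_tight[of a c' f b] c f f0 not_improvable False by blast
  qed
  show ?thesis
  proof (cases "c = {#}")
    case True
    then have "canonical c b f {#} u x m" if "1 \<le> x \<and> x + m \<le> u \<and> b = u + x \<and> f + m = u * x" for x u m
      using that by (simp add: canonical_def frame_def)
    with tight_split_exists[OF f f0] show ?thesis by blast
  next
    case False
    then obtain a where "a \<in># c" by blast
    then obtain x u m where xum: "1 \<le> x" "x + m \<le> u" "b = x + u" "f + m = x * u"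
      using tight by blast
    \<comment> \<open>A priori each part \<open>y\<close> comes with its own \<open>x'\<close>,
      \<open>u'\<close>, \<open>m'\<close>; they agree because \<open>b\<close> and \<open>f\<close>
      are shared.\<close>
    have "y = u \<or> y = u + 1" if y: "y \<in># c" for y
    proof -
      obtain x' u' m' where t: "x' + m' \<le> u'" "b = x' + u'" "f + m' = x' * u'" "y = u' \<or> y = u' + 1"
        using tight[OF y] by blast
      have "\<not> x < x'" "\<not> x' < x"
        using tight_split_unique[of x u x' u' f m m'] tight_split_unique[of x' u' x u f m' m] xum t by auto
      then have "u = u'" using xum t by simp
      with t show ?thesis by blast
    qed
    then have "canonical c b f c u x m"
      using xum by (simp add: canonical_def frame_def algebra_simps)
    then show ?thesis by blast
  qed
qed

text \<open>When \<open>e\<close> exceeds Mantel's bound for all vertices, a part of size 1 is split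
  off as a dominating vertex. Enough edges are present for this because
  \<open>4 * n \<le> (n + 1)^2\<close>.\<close>

lemma configuration_exists:
  assumes "e \<le> n choose 2"
  shows "\<exists>c b f. 0 \<notin># c \<and> 4 * f \<le> b\<^sup>2 \<and> coeff (cfg_poly c b f) 1 = n \<and> coeff (cfg_poly c b f) 2 = e"
  using assms
proof (induction n arbitrary: e)
  case 0
  then have "e = 0" by (simp add: numeral_2_eq_2)
  then have "0 \<notin># {#} \<and> 4 * 0 \<le> (0::nat)\<^sup>2 \<and> coeff (cfg_poly {#} 0 0) 1 = 0 \<and> coeff (cfg_poly {#} 0 0) 2 = e"
    by (simp add: coeff_cfg_poly_1 coeff_cfg_poly_2 coeff_parts_poly_eq_0 del: parts_poly_empty)
  then show ?case by blast
next
  case (Suc n)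
  show ?case
  proof (cases "4 * e \<le> (Suc n)\<^sup>2")
    case True
    then have "0 \<notin># {#} \<and> 4 * e \<le> (Suc n)\<^sup>2 \<and> coeff (cfg_poly {#} (Suc n) e) 1 = Suc n \<and>
        coeff (cfg_poly {#} (Suc n) e) 2 = e"
      by (simp add: coeff_cfg_poly_1 coeff_cfg_poly_2 coeff_parts_poly_eq_0 del: parts_poly_empty)
    then show ?thesis by blast
  next
    case False
    have "4 * int n \<le> (int (Suc n))\<^sup>2"
      using zero_le_power2[of "int n - 1"] by (simp add: power2_eq_square algebra_simps)
    then have "int (4 * n) \<le> int ((Suc n)\<^sup>2)" by simp
    then have "n \<le> e" using False by (simp only: of_nat_le_iff)
    have "Suc n choose 2 = (n choose 2) + n" by (simp add: numeral_2_eq_2)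
    then have "e - n \<le> n choose 2" using Suc.prems by simp
    from Suc.IH[OF this] obtain c b f where *: "0 \<notin># c" "4 * f \<le> b\<^sup>2"
      "coeff (cfg_poly c b f) 1 = n" "coeff (cfg_poly c b f) 2 = e - n" by blast
    have "cfg_poly (add_mset 1 c) b f = [:1, 1:] * cfg_poly c b f"
      by (simp only: cfg_poly_def parts_poly_add_mset mult.assoc)
    then have "coeff (cfg_poly (add_mset 1 c) b f) 1 = Suc n" "coeff (cfg_poly (add_mset 1 c) b f) 2 = e"
      using *(3,4) \<open>n \<le> e\<close> by (simp_all add: numeral_2_eq_2)
    moreover have "0 \<notin># add_mset 1 c" using *(1) by simp
    ultimately show ?thesis using *(2) by blast
  qed
qed

subsection \<open>Balanced parts and Turan numbers\<close>

text \<open>A Turan graph grown vertex by vertex: the vertex added to \<open>j\<close> earlier ones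
  joins a smallest class, of size \<open>j div s\<close>, and is adjacent to the rest.\<close>

definition turan_sum :: "nat \<Rightarrow> nat \<Rightarrow> nat" where
  "turan_sum s n = (\<Sum>j<n. j - j div s)"

lemma turan_sum_Suc: "turan_sum s (Suc n) = turan_sum s n + (n - n div s)"
  by (simp add: turan_sum_def)

lemma turan_sum_mono: "1 \<le> s \<Longrightarrow> s \<le> t \<Longrightarrow> turan_sum s n \<le> turan_sum t n"
  unfolding turan_sum_def by (intro sum_mono diff_le_mono2 div_le_mono2) auto

lemma coeff_parts_poly_add_mset_2:
  "coeff (parts_poly (add_mset a c)) 2 = coeff (parts_poly c) 2 + a * sum_mset c"
  by (simp add: numeral_2_eq_2 coeff_parts_poly_1)

lemma sum_mset_le_size_mult: "(\<And>y. y \<in># c \<Longrightarrow> y \<le> (x::nat)) \<Longrightarrow> sum_mset c \<le> size c * x"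
  by (induction c) (auto simp: add_mono)

lemma size_mult_le_sum_mset: "(\<And>y. y \<in># c \<Longrightarrow> (x::nat) \<le> y) \<Longrightarrow> size c * x \<le> sum_mset c"
  by (induction c) (auto simp: add_mono)

definition balanced :: "nat multiset \<Rightarrow> bool" where
  "balanced c \<longleftrightarrow> (\<forall>y\<in>#c. \<forall>z\<in>#c. y \<le> z + 1)"

text \<open>Remove a vertex from a largest part. By pigeonhole that part is large, so the vertex has
  at most the degree that \<open>turan_sum\<close> allots to it; for balanced parts the degree is
  exactly this, and balance survives the removal.\<close>

lemma coeff_parts_poly_2_le_turan_sum:
  "coeff (parts_poly c) 2 \<le> turan_sum (size c) (sum_mset c) \<and>
   (balanced c \<longrightarrow> coeff (parts_poly c) 2 = turan_sum (size c) (sum_mset c))"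
proof (induction n \<equiv> "sum_mset c" arbitrary: c)
  case 0
  then have "filter_mset ((<) 0) c = filter_mset (\<lambda>_. False) c"
    by (intro filter_mset_cong) auto
  then have "filter_mset ((<) 0) c = {#}" by simp
  then have "parts_poly c = 1"
    by (metis parts_poly_filter_pos parts_poly_empty)
  then show ?case by (simp flip: 0 add: turan_sum_def)
next
  case (Suc n)
  then have "c \<noteq> {#}" by auto
  define x where "x = Max_mset c"
  have "x \<in># c" using \<open>c \<noteq> {#}\<close> by (simp add: x_def)
  then obtain d where c: "c = add_mset x d" by (metis insert_DiffM)
  have le_x: "y \<le> x" if "y \<in># c" for y using that by (simp add: x_def)
  have "Suc n \<le> size c * x" using sum_mset_le_size_mult[of c x] le_x Suc.hyps(2) by simp
  then have div_less: "n div size c < x" by (intro less_mult_imp_div_less) (simp add: mult.commute)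
  then obtain w where w: "x = Suc w" by (cases x) auto
  define c' where "c' = add_mset w d"
  have sum: "sum_mset c' = n" "sum_mset d = n - w" "w \<le> n" and size: "size c' = size c"
    using Suc.hyps(2) by (simp_all add: c c'_def w)
  have step: "coeff (parts_poly c) 2 = coeff (parts_poly c') 2 + (n - w)"
    by (simp only: c c'_def coeff_parts_poly_add_mset_2 sum(2) w) simp
  have IH: "coeff (parts_poly c') 2 \<le> turan_sum (size c) n"
    "balanced c' \<Longrightarrow> coeff (parts_poly c') 2 = turan_sum (size c) n"
    using Suc.hyps(1)[of c'] sum size by auto
  have "n - w \<le> n - n div size c" using div_less w by simp
  moreover have "n - w = n - n div size c" "balanced c'" if bal: "balanced c"
  proof -
    have ge: "w \<le> y" if "y \<in># c" for y
      using bal that \<open>x \<in># c\<close> w unfolding balanced_def by fastforce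
    have "size d * w \<le> sum_mset d" using size_mult_le_sum_mset[of d w] ge c by simp
    then have "w * size c \<le> n" using sum c by (simp add: mult.commute)
    then have "w \<le> n div size c" by (simp add: c less_eq_div_iff_mult_less_eq)
    then show "n - w = n - n div size c" using div_less w by simp
    have "w \<le> y \<and> y \<le> w + 1" if "y \<in># c'" for y
      using that ge[of y] le_x[of y] w unfolding c c'_def by auto
    then show "balanced c'" unfolding balanced_def by (meson add_le_cancel_right order_trans)
  qed
  ultimately show ?case
    unfolding step Suc.hyps(2)[symmetric] turan_sum_Suc using IH by (metis add_mono)
qed

subsection \<open>Clique polynomials of joins\<close>

definition clique_poly :: "'a set \<Rightarrow> 'a set set \<Rightarrow> nat poly" where
  "clique_poly V E = (\<Sum>S | S \<subseteq> V \<and> clique S E. monom 1 (card S))"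

lemma coeff_clique_poly:
  assumes "finite V"
  shows "coeff (clique_poly V E) r = card {S \<in> [V]\<^bsup>r\<^esup>. clique S E}"
proof -
  have fin: "finite {S. S \<subseteq> V \<and> clique S E}" using assms by simp
  have "coeff (clique_poly V E) r = card ({S. S \<subseteq> V \<and> clique S E} \<inter> {S. card S = r})"
    unfolding clique_poly_def coeff_sum coeff_monom by (simp add: sum.If_cases[OF fin])
  also have "{S. S \<subseteq> V \<and> clique S E} \<inter> {S. card S = r} = {S \<in> [V]\<^bsup>r\<^esup>. clique S E}"
    using assms by (auto simp: nsets_def intro: finite_subset)
  finally show ?thesis .
qed

text \<open>A clique of a join is, in a unique way, a clique on one side united with a clique on the
  other. All three polynomials use the same ambient \<open>E\<close>, of which only the trace on the
  given vertex set matters.\<close>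

lemma clique_poly_Un:
  assumes "finite V" "finite W" "V \<inter> W = {}"
    and cross: "\<And>x y. x \<in> V \<Longrightarrow> y \<in> W \<Longrightarrow> {x, y} \<in> E"
  shows "clique_poly (V \<union> W) E = clique_poly V E * clique_poly W E"
proof -
  have "clique_poly V E * clique_poly W E =
      (\<Sum>(S, T)\<in>{S. S \<subseteq> V \<and> clique S E} \<times> {T. T \<subseteq> W \<and> clique T E}. monom 1 (card S + card T))"
    by (simp add: clique_poly_def sum_product sum.cartesian_product mult_monom)
  also have "\<dots> = clique_poly (V \<union> W) E"
    unfolding clique_poly_def
  proof (rule sum.reindex_bij_witness[where i = "\<lambda>S. (S \<inter> V, S \<inter> W)" and j = "\<lambda>(S, T). S \<union> T"])
    fix p assume p: "p \<in> {S. S \<subseteq> V \<and> clique S E} \<times> {T. T \<subseteq> W \<and> clique T E}"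
    obtain S T where ST: "p = (S, T)" by (cases p)
    with p have *: "S \<subseteq> V" "clique S E" "T \<subseteq> W" "clique T E" by auto
    show "((case p of (S, T) \<Rightarrow> S \<union> T) \<inter> V, (case p of (S, T) \<Rightarrow> S \<union> T) \<inter> W) = p"
      using * assms(3) unfolding ST by auto
    have "{x, y} \<in> E" if "x \<in> S" "y \<in> T" for x y using that * cross by blast
    then have "clique (S \<union> T) E"
      using *(2,4) unfolding clique_def by (metis Un_iff insert_commute)
    then show "(case p of (S, T) \<Rightarrow> S \<union> T) \<in> {S. S \<subseteq> V \<union> W \<and> clique S E}"
      using * unfolding ST by auto
    have "finite S" "finite T" "S \<inter> T = {}" using * assms finite_subset by blast+
    then show "monom 1 (card (case p of (S, T) \<Rightarrow> S \<union> T)) = (case p of (S, T) \<Rightarrow> monom (1::nat) (card S + card T))"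
      unfolding ST by (simp add: card_Un_disjoint)
  next
    fix S assume "S \<in> {S. S \<subseteq> V \<union> W \<and> clique S E}"
    then show "(case (S \<inter> V, S \<inter> W) of (S, T) \<Rightarrow> S \<union> T) = S"
      "(S \<inter> V, S \<inter> W) \<in> {S. S \<subseteq> V \<and> clique S E} \<times> {T. T \<subseteq> W \<and> clique T E}"
      by (auto simp: clique_def)
  qed
  finally show ?thesis ..
qed

lemma clique_poly_empty [simp]: "clique_poly {} E = 1"
proof -
  have "{S. S \<subseteq> {} \<and> clique S E} = {{}}" by (auto simp: clique_def)
  then show ?thesis by (simp add: clique_poly_def flip: One_nat_def)
qed

lemma clique_poly_UN:
  assumes "finite J" "\<And>j. j \<in> J \<Longrightarrow> finite (B j)" "disjoint_family_on B J"
    and "\<And>i j x y. i \<in> J \<Longrightarrow> j \<in> J \<Longrightarrow> i \<noteq> j \<Longrightarrow> x \<in> B i \<Longrightarrow> y \<in> B j \<Longrightarrow> {x, y} \<in> E"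
  shows "clique_poly (\<Union>j\<in>J. B j) E = (\<Prod>j\<in>J. clique_poly (B j) E)"
  using assms
proof (induction J rule: finite_induct)
  case (insert i J)
  have "clique_poly (B i \<union> (\<Union>j\<in>J. B j)) E = clique_poly (B i) E * clique_poly (\<Union>j\<in>J. B j) E"
  proof (rule clique_poly_Un)
    show "B i \<inter> (\<Union>j\<in>J. B j) = {}"
      using insert.prems(2) insert.hyps(2) by (fastforce simp: disjoint_family_on_def)
    show "{x, y} \<in> E" if "x \<in> B i" "y \<in> (\<Union>j\<in>J. B j)" for x y
      using that insert.prems(3) insert.hyps(2) by blast
  qed (use insert.hyps insert.prems in auto)
  moreover have "clique_poly (\<Union>j\<in>J. B j) E = (\<Prod>j\<in>J. clique_poly (B j) E)"
  proof (rule insert.IH)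
    show "{x, y} \<in> E" if "k \<in> J" "j \<in> J" "k \<noteq> j" "x \<in> B k" "y \<in> B j" for k j x y
      using that insert.prems(3) by blast
  qed (use insert.prems in \<open>auto simp: disjoint_family_on_def\<close>)
  ultimately show ?case using insert.hyps by simp
qed simp

lemma clique_poly_triangle_free:
  assumes V: "fin_graph (V, F)" "triangle_free (V, F)"
    and E: "\<And>x y. x \<in> V \<Longrightarrow> y \<in> V \<Longrightarrow> x \<noteq> y \<Longrightarrow> {x, y} \<in> E \<longleftrightarrow> {x, y} \<in> F"
  shows "clique_poly V E = [:1, card V, card F:]"
proof (rule poly_eqI)
  fix r :: nat
  have fin: "finite V" and F: "F \<subseteq> [V]\<^bsup>2\<^esup>" using V(1) by (auto simp: fin_graph_def verts_def edges_def)
  have clique_eq: "clique S E \<longleftrightarrow> clique S F" if "S \<subseteq> V" for S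
    using that E by (auto simp: clique_def subset_iff)
  consider "r = 0" | "r = 1" | "r = 2" | "3 \<le> r" by linarith
  then show "coeff (clique_poly V E) r = coeff [:1, card V, card F:] r"
  proof cases
    case 1
    have "{S \<in> [V]\<^bsup>0\<^esup>. clique S E} = {{}}" by (auto simp: nsets_def clique_def)
    then show ?thesis using 1 by (simp add: coeff_clique_poly[OF fin])
  next
    case 2
    have "{S \<in> [V]\<^bsup>1\<^esup>. clique S E} = (\<lambda>x. {x}) ` V"
      by (auto simp: nsets_def clique_def card_1_singleton_iff)
    then show ?thesis using 2 by (simp add: coeff_clique_poly[OF fin] card_image)
  next
    case 3
    have "clique S E \<longleftrightarrow> S \<in> F" if S: "S \<in> [V]\<^bsup>2\<^esup>" for S
    proof -
      obtain x y where "S = {x, y}" "x \<in> V" "y \<in> V" "x \<noteq> y" using S by (rule nsets2_E)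
      then show ?thesis using E[of x y] by (auto simp: clique_def insert_commute)
    qed
    then have "{S \<in> [V]\<^bsup>2\<^esup>. clique S E} = F" using F by auto
    then show ?thesis using 3 by (simp add: coeff_clique_poly[OF fin] numeral_2_eq_2)
  next
    case 4
    have "\<not> clique S E" if S: "S \<in> [V]\<^bsup>r\<^esup>" for S
    proof
      assume "clique S E"
      have "S \<subseteq> V" "finite S" "card S = r" using S by (auto simp: nsets_def)
      then obtain R where "R \<subseteq> S" "card R = 3" using 4 obtain_subset_with_card_n[of 3 S] by metis
      then have "R \<in> [V]\<^bsup>3\<^esup>"
        using \<open>S \<subseteq> V\<close> \<open>finite S\<close> by (auto simp: nsets_def intro: finite_subset)
      moreover have "clique S F" using \<open>clique S E\<close> \<open>S \<subseteq> V\<close> clique_eq by blast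
      then have "clique R F" using \<open>R \<subseteq> S\<close> by (meson clique_def subsetD)
      ultimately      show False using V(2) by (auto simp: triangle_free_def verts_def edges_def)
    qed
    then have "{S \<in> [V]\<^bsup>r\<^esup>. clique S E} = {}" by blast
    then have "coeff (clique_poly V E) r = 0" by (simp only: coeff_clique_poly[OF fin] card.empty)
    moreover obtain s where "r = 3 + s" using le_Suc_ex[OF 4] by blast
    then have "coeff [:1, card V, card F:] r = 0" by (simp add: numeral_3_eq_3)
    ultimately show ?thesis by simp
  qed
qed

lemma triangle_free_empty: "triangle_free (W, {})"
  unfolding triangle_free_def clique_def nsets_3_eq by (auto simp: verts_def edges_def)

lemma clique_poly_independent:
  assumes "finite V" "\<And>x y. x \<in> V \<Longrightarrow> y \<in> V \<Longrightarrow> x \<noteq> y \<Longrightarrow> {x, y} \<notin> E"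
  shows "clique_poly V E = [:1, card V:]"
proof -
  have "clique_poly V E = [:1, card V, card ({} :: 'a set set):]"
  proof (rule clique_poly_triangle_free)
    show "triangle_free (V, {})" by (rule triangle_free_empty)
  qed (use assms in \<open>auto simp: fin_graph_def verts_def edges_def\<close>)
  then show ?thesis by simp
qed

text \<open>The special part \<open>W\<close> is kept apart from the independent parts, whose index
  set \<open>J\<close> is arbitrary, so that parts can be inserted, dropped and renumbered freely.
  Complete multipartite graphs are the case \<open>W = {}\<close>.\<close>

definition join_graph :: "nat set \<Rightarrow> (nat \<Rightarrow> 'a set) \<Rightarrow> 'a set \<Rightarrow> 'a set set \<Rightarrow> 'a graph" where
  "join_graph J B W F =
     (W \<union> (\<Union>j\<in>J. B j),
      {{x, y} | x y. \<exists>i\<in>J. \<exists>j\<in>J. i \<noteq> j \<and> x \<in> B i \<and> y \<in> B j} \<union>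
      {{x, y} | x y. x \<in> W \<and> (\<exists>j\<in>J. y \<in> B j)} \<union> F)"

definition joinable :: "nat set \<Rightarrow> (nat \<Rightarrow> 'a set) \<Rightarrow> 'a set \<Rightarrow> 'a set set \<Rightarrow> bool" where
  "joinable J B W F \<longleftrightarrow> finite J \<and> (\<forall>j\<in>J. finite (B j)) \<and> disjoint_family_on B J \<and>
     (\<forall>j\<in>J. W \<inter> B j = {}) \<and> fin_graph (W, F) \<and> triangle_free (W, F)"

abbreviation card_mset :: "nat set \<Rightarrow> (nat \<Rightarrow> 'a set) \<Rightarrow> nat multiset" where
  "card_mset J B \<equiv> image_mset (\<lambda>j. card (B j)) (mset_set J)"

lemma doubleton_mem_Collect_iff:
  "{x, y} \<in> {{a, b} | a b. P a b} \<longleftrightarrow> P x y \<or> P y x"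
  by (auto simp: doubleton_eq_iff)

lemma edges_join_graph_iff:
  "{x, y} \<in> edges (join_graph J B W F) \<longleftrightarrow>
     (\<exists>i\<in>J. \<exists>j\<in>J. i \<noteq> j \<and> x \<in> B i \<and> y \<in> B j) \<or>
     x \<in> W \<and> (\<exists>j\<in>J. y \<in> B j) \<or> y \<in> W \<and> (\<exists>j\<in>J. x \<in> B j) \<or> {x, y} \<in> F"
  proof -
  have cross: "(\<exists>i\<in>J. \<exists>j\<in>J. i \<noteq> j \<and> y \<in> B i \<and> x \<in> B j) \<longleftrightarrow>
      (\<exists>i\<in>J. \<exists>j\<in>J. i \<noteq> j \<and> x \<in> B i \<and> y \<in> B j)"
    by metis
  show ?thesis
    unfolding join_graph_def edges_def snd_conv Un_iff doubleton_mem_Collect_iff cross by simp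
qed

lemma fin_graph_join_graph: "joinable J B W F \<Longrightarrow> fin_graph (join_graph J B W F)"
  unfolding fin_graph_def
proof
  assume J: "joinable J B W F"
  then show "finite (verts (join_graph J B W F))"
    by (auto simp: joinable_def join_graph_def verts_def fin_graph_def)
  show "edges (join_graph J B W F) \<subseteq> [verts (join_graph J B W F)]\<^bsup>2\<^esup>"
  proof
    fix d assume "d \<in> edges (join_graph J B W F)"
    then consider x y i j where "d = {x, y}" "i \<in> J" "j \<in> J" "i \<noteq> j" "x \<in> B i" "y \<in> B j"
      | x y j where "d = {x, y}" "x \<in> W" "j \<in> J" "y \<in> B j" | "d \<in> F"
      unfolding join_graph_def edges_def by auto
    then show "d \<in> [verts (join_graph J B W F)]\<^bsup>2\<^esup>"
    proof cases
      case 3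
      then have "d \<in> [W]\<^bsup>2\<^esup>" using J by (auto simp: joinable_def fin_graph_def verts_def edges_def)
      then show ?thesis by (rule subsetD[OF nsets_mono, rotated]) (auto simp: join_graph_def verts_def)
    qed (use J in \<open>auto simp: joinable_def disjoint_family_on_def join_graph_def verts_def\<close>)
  qed
qed

lemma clique_poly_join_graph:
  assumes "joinable J B W F"
  shows "clique_poly (verts (join_graph J B W F)) (edges (join_graph J B W F)) =
     cfg_poly (card_mset J B) (card W) (card F)"
proof -
  let ?E = "edges (join_graph J B W F)"
  have *: "finite J" "\<And>j. j \<in> J \<Longrightarrow> finite (B j)" "disjoint_family_on B J"
    "\<And>j. j \<in> J \<Longrightarrow> W \<inter> B j = {}" "fin_graph (W, F)" "triangle_free (W, F)"
    using assms by (auto simp: joinable_def)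
  then have finW: "finite W" and F: "F \<subseteq> [W]\<^bsup>2\<^esup>" by (auto simp: fin_graph_def verts_def edges_def)
  have eq_index: "i = j" if "i \<in> J" "j \<in> J" "x \<in> B i" "x \<in> B j" for i j x
    using that *(3) by (auto simp: disjoint_family_on_def)
  have "x \<in> W" if "{x, y} \<in> F" for x y
    using subsetD[OF F that] by simp
  then have not_F: "{x, y} \<notin> F" if "j \<in> J" "x \<in> B j" for x y j
    using that *(4)[of j] by blast
  have "clique_poly (W \<union> (\<Union>j\<in>J. B j)) ?E = clique_poly W ?E * clique_poly (\<Union>j\<in>J. B j) ?E"
    using * finW by (intro clique_poly_Un) (auto simp: edges_join_graph_iff)
  moreover have "clique_poly (\<Union>j\<in>J. B j) ?E = (\<Prod>j\<in>J. clique_poly (B j) ?E)"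
    using * by (intro clique_poly_UN) (auto simp: edges_join_graph_iff)
  moreover have "clique_poly (B j) ?E = [:1, card (B j):]" if j: "j \<in> J" for j
  proof (rule clique_poly_independent)
    fix x y assume "x \<in> B j" "y \<in> B j"
    then show "{x, y} \<notin> ?E"
      using eq_index[of _ j] *(4)[OF j] not_F[OF j] j unfolding edges_join_graph_iff by blast
  qed (use * j in auto)
  moreover have "clique_poly W ?E = [:1, card W, card F:]"
  proof (rule clique_poly_triangle_free[OF *(5,6)])
    fix x y assume "x \<in> W" "y \<in> W" "x \<noteq> y"
    then show "{x, y} \<in> ?E \<longleftrightarrow> {x, y} \<in> F"
      using *(4) unfolding edges_join_graph_iff by blast
  qed
  moreover have "verts (join_graph J B W F) = W \<union> (\<Union>j\<in>J. B j)"
    by (simp add: join_graph_def verts_def)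
  ultimately show ?thesis
    by (simp add: cfg_poly_def parts_poly_def prod_unfold_prod_mset
        image_mset.compositionality comp_def mult.commute del: mult_pCons_left mult_pCons_right)
qed

lemma num_cliques_join_graph:
  "joinable J B W F \<Longrightarrow>
     num_cliques r (join_graph J B W F) = coeff (cfg_poly (card_mset J B) (card W) (card F)) r"
  using fin_graph_join_graph[of J B W F]
  by (simp add: num_cliques_def fin_graph_def flip: coeff_clique_poly clique_poly_join_graph)

lemma num_cliques_1: "fin_graph G \<Longrightarrow> num_cliques 1 G = card (verts G)"
proof -
  have "{S \<in> [verts G]\<^bsup>1\<^esup>. clique S (edges G)} = (\<lambda>x. {x}) ` verts G"
    by (auto simp: nsets_def clique_def card_1_singleton_iff)
  then show ?thesis by (simp add: num_cliques_def card_image)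
qed

lemma num_cliques_2: "fin_graph G \<Longrightarrow> num_cliques 2 G = card (edges G)"
proof -
  assume "fin_graph G"
  then have E: "edges G \<subseteq> [verts G]\<^bsup>2\<^esup>" by (simp add: fin_graph_def)
  have "clique S (edges G) \<longleftrightarrow> S \<in> edges G" if "S \<in> [verts G]\<^bsup>2\<^esup>" for S
    using that by (auto elim!: nsets2_E simp: clique_def insert_commute)
  then have "{S \<in> [verts G]\<^bsup>2\<^esup>. clique S (edges G)} = edges G" using E by auto
  then show ?thesis by (simp add: num_cliques_def)
qed

lemma ne_graph_join_graph:
  assumes "joinable J B W F"
  shows "ne_graph n e (join_graph J B W F) \<longleftrightarrow>
     coeff (cfg_poly (card_mset J B) (card W) (card F)) 1 = n \<and>
     coeff (cfg_poly (card_mset J B) (card W) (card F)) 2 = e"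
  using fin_graph_join_graph[OF assms] num_cliques_1[of "join_graph J B W F"]
    num_cliques_2[of "join_graph J B W F"]
  unfolding ne_graph_def num_cliques_join_graph[OF assms] by metis

lemma multipartite_eq_join_graph: "multipartite l A = join_graph {1..l} A {} {}"
  by (simp add: multipartite_def join_graph_def)

lemma card_residue_class:
  assumes "i < s"
  shows "card {x. x < n \<and> x mod s = i} = n div s + (if i < n mod s then 1 else 0)"
proof (induction n)
  case (Suc n)
  have "{x. x < Suc n \<and> x mod s = i} = (if n mod s = i then insert n {x. x < n \<and> x mod s = i} else {x. x < n \<and> x mod s = i})"
    by (auto simp: less_Suc_eq)
  then have "card {x. x < Suc n \<and> x mod s = i} = card {x. x < n \<and> x mod s = i} + (if n mod s = i then 1 else 0)"
    by simp
  then show ?case unfolding Suc.IH using assms by (auto simp: div_Suc mod_Suc)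
qed simp

lemma turan_num_eq_turan_sum:
  assumes "1 \<le> s"
  shows "turan_num s n = turan_sum s n"
proof -
  define A where "A = (\<lambda>i. {x. x < n \<and> x mod s = i - 1})"
  have inj: "i = j" if "x \<in> A i" "x \<in> A j" "i \<in> {1..s}" "j \<in> {1..s}" for i j x
    using that by (auto simp: A_def)
  then have join: "joinable {1..s} A {} {}"
    using triangle_free_empty[of "{}"]
    by (auto simp: joinable_def disjoint_family_on_def A_def fin_graph_def verts_def edges_def)
  define c where "c = card_mset {1..s} A"
  have cards: "card (A i) = n div s + (if i - 1 < n mod s then 1 else 0)" if "i \<in> {1..s}" for i
    unfolding A_def using that by (intro card_residue_class) auto
  have "balanced c" unfolding balanced_def c_def using cards by auto
  then have 1: "coeff (parts_poly c) 2 = turan_sum s (sum_mset c)"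
    using coeff_parts_poly_2_le_turan_sum[of c] by (simp add: c_def)
  have poly: "cfg_poly c 0 0 = parts_poly c" by (simp add: cfg_poly_def)
  have graph: "turan_graph s n = join_graph {1..s} A {} {}"
    by (simp add: turan_graph_def multipartite_eq_join_graph A_def)
  have "turan_num s n = num_cliques 2 (join_graph {1..s} A {} {})"
    unfolding turan_num_def graph by (rule num_cliques_2[OF fin_graph_join_graph[OF join], symmetric])
  also have "\<dots> = coeff (parts_poly c) 2"
    unfolding num_cliques_join_graph[OF join] c_def[symmetric] by (simp add: poly)
  also have "\<dots> = turan_sum s (sum_mset c)" by (rule 1)
  also have "sum_mset c = n"
  proof -
    have "sum_mset c = coeff (cfg_poly c 0 0) 1" by (simp add: coeff_cfg_poly_1)
    also have "\<dots> = card (verts (join_graph {1..s} A {} {}))"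
      using num_cliques_1[OF fin_graph_join_graph[OF join]] num_cliques_join_graph[OF join, of 1]
      by (simp add: c_def)
    also have "verts (join_graph {1..s} A {} {}) = {..<n}"
    proof -
      have "x \<in> A (Suc (x mod s))" "Suc (x mod s) \<in> {1..s}" if "x < n" for x
        using that assms by (auto simp: A_def Suc_leI)
      then show ?thesis by (force simp: join_graph_def verts_def A_def)
    qed
    finally show ?thesis by simp
  qed
  finally show ?thesis .
qed

subsection \<open>The optimal parts\<close>

text \<open>The entries above the minimum form an initial segment that misses position
  \<open>s\<close>, so its length is the remainder of \<open>N\<close> modulo \<open>s\<close>. This
  settles the uniqueness demanded by the description of \<open>a_star\<close>.\<close>

lemma balanced_vector_unique:
  fixes a :: "nat \<Rightarrow> nat"
  assumes "1 \<le> s"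
    and decr: "\<And>i j. i \<in> {1..s} \<Longrightarrow> j \<in> {1..s} \<Longrightarrow> i \<le> j \<Longrightarrow> a j \<le> a i"
    and bal: "a 1 \<le> a s + 1" and sum: "(\<Sum>i\<in>{1..s}. a i) = N" and i: "i \<in> {1..s}"
  shows "a i = N div s + (if i \<le> N mod s then 1 else 0)"
proof -
  define w where "w = a s"
  define I where "I = {i \<in> {1..s}. a i = w + 1}"
  have a_eq: "a j = w + (if j \<in> I then 1 else 0)" if "j \<in> {1..s}" for j
    using that decr[of 1 j] decr[of j s] bal \<open>1 \<le> s\<close> by (auto simp: I_def w_def)
  have mem_I: "j \<in> I \<longleftrightarrow> j \<le> card I" if j: "j \<in> {1..s}" for j
  proof
    assume "j \<in> I"
    have "{1..j} \<subseteq> I"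
    proof
      fix l assume "l \<in> {1..j}"
      then have "l \<in> {1..s}" "a j \<le> a l" using decr[of l j] j by auto
      then show "l \<in> I" using a_eq[of l] a_eq[OF j] \<open>j \<in> I\<close> by (cases "l \<in> I") auto
    qed
    then have "card {1..j} \<le> card I" by (intro card_mono) (simp_all add: I_def)
    then show "j \<le> card I" by simp
  next
    assume "j \<le> card I"
    show "j \<in> I"
    proof (rule ccontr)
      assume "j \<notin> I"
      have "l < j" if "l \<in> I" for l
      proof (rule ccontr)
        assume "\<not> l < j"
        then have "l \<in> {1..s}" "a l = w + 1" "j \<le> l" using that by (simp_all add: I_def)
        then show False using decr[of j l] a_eq[OF j] j \<open>j \<notin> I\<close> by simp
      qed
      then have "I \<subseteq> {1..<j}" by (auto simp: I_def)
      then have "card I \<le> card {1..<j}" by (intro card_mono) simp_all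
      then show False using \<open>j \<le> card I\<close> j by auto
    qed
  qed
  have "I \<subseteq> {1..<s}"
  proof
    fix j assume "j \<in> I"
    then show "j \<in> {1..<s}" by (cases "j = s") (auto simp: I_def w_def)
  qed
  then have "card I \<le> card {1..<s}" by (intro card_mono) simp_all
  then have "card I < s" using \<open>1 \<le> s\<close> by simp
  have "N = (\<Sum>j\<in>{1..s}. w + (if j \<in> I then 1 else 0))"
    unfolding sum[symmetric] by (intro sum.cong) (simp_all add: a_eq)
  also have "\<dots> = s * w + card I"
  proof -
    have "{1..s} \<inter> {j. j \<in> I} = I" by (auto simp: I_def)
    then show ?thesis unfolding sum.distrib by (simp add: sum.If_cases)
  qed
  finally have "N div s = w" "N mod s = card I" using \<open>card I < s\<close> by simp_all
  then show ?thesis using a_eq[OF i] mem_I[OF i] by simp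
qed

lemma sum_prods_eq_coeff:
  "sum_prods a l s = coeff (parts_poly (image_mset a (mset_set {1..l}))) s"
proof -
  have "parts_poly (image_mset a (mset_set {1..l})) = (\<Prod>i\<in>{1..l}. [:1, a i:])"
    by (simp add: parts_poly_def prod_unfold_prod_mset image_mset.compositionality comp_def)
  also have "\<dots> = (\<Prod>i\<in>{1..l}. monom (a i) 1 + 1)"
    by (intro prod.cong) (simp_all add: monom_Suc monom_0 one_pCons)
  also have "\<dots> = (\<Sum>S\<in>Pow {1..l}. (\<Prod>i\<in>S. monom (a i) 1) * (\<Prod>i\<in>{1..l} - S. 1))"
    by (rule prod_add) simp
  also have "\<dots> = (\<Sum>S\<in>Pow {1..l}. monom (\<Prod>i\<in>S. a i) (card S))"
  proof (rule sum.cong)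
    fix S assume "S \<in> Pow {1..l}"
    then have "finite S" by (auto intro: finite_subset)
    then have "(\<Prod>i\<in>S. monom (a i) 1) = monom (\<Prod>i\<in>S. a i) (card S)"
      by (induction S rule: finite_induct) (simp_all add: mult_monom monom_0 one_pCons)
    then show "(\<Prod>i\<in>S. monom (a i) 1) * (\<Prod>i\<in>{1..l} - S. 1) = monom (\<Prod>i\<in>S. a i) (card S)" by simp
  qed simp
  finally have "coeff (parts_poly (image_mset a (mset_set {1..l}))) s =
      (\<Sum>S\<in>Pow {1..l}. if card S = s then \<Prod>i\<in>S. a i else 0)"
    by (simp add: coeff_sum)
  also have "\<dots> = (\<Sum>S\<in>Pow {1..l} \<inter> {S. card S = s}. \<Prod>i\<in>S. a i)"
    by (simp add: sum.If_cases)
  also have "Pow {1..l} \<inter> {S. card S = s} = [{1..l}]\<^bsup>s\<^esup>"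
    by (auto simp: nsets_def intro: finite_subset)
  finally show ?thesis by (simp add: sum_prods_def)
qed

lemma image_mset_nth_pred: "image_mset (\<lambda>i. L ! (i - 1)) (mset_set {1..length L}) = mset L"
proof -
  have "mset_set {1..length L} = image_mset Suc (mset_set {..<length L})"
    by (subst image_mset_mset_set) (simp_all add: image_Suc_lessThan)
  then have "image_mset (\<lambda>i. L ! (i - 1)) (mset_set {1..length L}) = image_mset (nth L) (mset [0..<length L])"
    by (simp add: image_mset.compositionality comp_def mset_set_upto_eq_mset_upto)
  also have "\<dots> = mset L" by (metis map_nth mset_map)
  finally show ?thesis .
qed

text \<open>Here \<open>e + m\<close> counts the edges of the complete multipartite graph with parts
  \<open>D\<close>, \<open>u\<close>, \<open>x\<close>. These numerical conditions suffice to
  compute \<open>k_opt\<close>, \<open>last_part\<close>, \<open>a_star\<close> and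
  \<open>m_star\<close>.\<close>

locale star_config =
  fixes D :: "nat multiset" and u x m n e :: nat
  assumes frame: "frame D u x m"
    and order: "sum_mset D + u + x = n"
    and edges_count: "coeff (parts_poly (D + {#u, x#})) 2 = e + m"
begin

lemma parts: "y \<in># D \<Longrightarrow> y = u \<or> y = u + 1" and small: "1 \<le> x" "x + m \<le> u"
  using frame by (auto simp: frame_def)

lemma div_eq: "(n - x) div Suc (size D) = u"
proof -
  have "size D * u \<le> sum_mset D" by (intro size_mult_le_sum_mset) (auto dest: parts)
  moreover have "sum_mset D \<le> size D * (u + 1)" by (intro sum_mset_le_size_mult) (auto dest: parts)
  moreover have "n - x = sum_mset D + u" using order by simp
  ultimately have "Suc (size D) * u \<le> n - x" "n - x < Suc (size D) * Suc u" by simp_all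
  then show ?thesis by (metis div_nat_eqI mult.commute)
qed

definition joined :: "nat \<Rightarrow> nat" where
  "joined a = a * (n - a) + turan_sum (Suc (size D)) (n - a)"

text \<open>A vertex moved into the last part gains the \<open>(n - Suc a) div Suc (size D)\<close>
  other vertices of its old class as neighbours and loses the \<open>a\<close> vertices already in
  the last part. The additive form avoids a possibly negative difference.\<close>

lemma joined_Suc:
  assumes "a < n"
  shows "joined (Suc a) + a = joined a + (n - Suc a) div Suc (size D)"
proof -
  define N where "N = n - Suc a"
  have N: "n - a = Suc N" "n - Suc a = N" using assms by (simp_all add: N_def)
  have "N div Suc (size D) \<le> N" by (rule div_le_dividend)
  then show ?thesis unfolding joined_def N turan_sum_Suc by (simp only: mult_Suc mult_Suc_right)
qed

lemma joined_x: "joined x = e + m"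
proof -
  have "balanced (add_mset u D)" unfolding balanced_def by (auto dest!: parts)
  then have "coeff (parts_poly (add_mset u D)) 2 = turan_sum (Suc (size D)) (sum_mset D + u)"
    using coeff_parts_poly_2_le_turan_sum[of "add_mset u D"] by (simp add: add.commute)
  moreover have "e + m = coeff (parts_poly (add_mset x (add_mset u D))) 2"
    using edges_count by (simp add: add_mset_commute)
  moreover have "n - x = sum_mset D + u" using order by simp
  ultimately show ?thesis
    unfolding joined_def coeff_parts_poly_add_mset_2 by (simp add: add.commute)
qed

text \<open>The last step up to \<open>x\<close> gains \<open>u - (x - 1)\<close>, more than the
  surplus \<open>m\<close>, and all earlier steps gain as well. The value at \<open>a = 0\<close>
  gives minimality of \<open>k_opt\<close>, the other values that of
  \<open>last_part\<close>.\<close>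

lemma joined_less: "a < x \<Longrightarrow> joined a < e"
proof (induction "x - Suc a" arbitrary: a)
  case 0
  then have a: "x = Suc a" by simp
  have "joined x + a = joined a + u" using joined_Suc[of a] div_eq order a by simp
  then show ?case using joined_x small a by linarith
next
  case (Suc d)
  then have "joined (Suc a) < e" by simp
  moreover have "u \<le> (n - Suc a) div Suc (size D)"
    unfolding div_eq[symmetric] using Suc.prems by (intro div_le_mono) simp
  then have "joined a \<le> joined (Suc a)"
    using joined_Suc[of a] order Suc.prems small by linarith
  ultimately show ?case by simp
qed

lemma edges_le_turan_sum: "e \<le> turan_sum (size D + 2) n"
proof -
  have "sum_mset (D + {#u, x#}) = n" using order by simp
  then show ?thesis
    using coeff_parts_poly_2_le_turan_sum[of "D + {#u, x#}"] edges_count by simp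
qed

lemma k_opt_eq: "k_opt n e = size D + 2"
  unfolding k_opt_def
proof (rule Least_equality)
  show "1 \<le> size D + 2 \<and> e \<le> turan_num (size D + 2) n"
    using edges_le_turan_sum by (simp add: turan_num_eq_turan_sum)
next
  fix s assume s: "1 \<le> s \<and> e \<le> turan_num s n"
  show "size D + 2 \<le> s"
  proof (rule ccontr)
    assume "\<not> size D + 2 \<le> s"
    \<comment> \<open>At \<open>a = 0\<close> the bound \<open>joined\<close> is the Turan number
      with one part fewer.\<close>
    then have "turan_sum s n \<le> joined 0"
      using s by (simp add: joined_def turan_sum_mono)
    moreover have "turan_num s n = turan_sum s n" using s turan_num_eq_turan_sum by blast
    ultimately show False using joined_less[of 0] s small by simp
  qed
qed

lemma last_part_eq: "last_part n e = x"
  unfolding last_part_def k_opt_eq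
proof (rule Least_equality)
  show "1 \<le> x \<and> x \<le> n \<and> e \<le> x * (n - x) + turan_num (size D + 2 - 1) (n - x)"
    using joined_x small order by (simp add: joined_def turan_num_eq_turan_sum)
next
  fix a assume "1 \<le> a \<and> a \<le> n \<and> e \<le> a * (n - a) + turan_num (size D + 2 - 1) (n - a)"
  then show "x \<le> a" using joined_less[of a] by (cases "a < x") (simp_all add: joined_def turan_num_eq_turan_sum)
qed

definition vec :: "nat \<Rightarrow> nat" where
  "vec i = (if i \<in> {1..size D} then rev (sorted_list_of_multiset D) ! (i - 1)
     else if i = Suc (size D) then u else if i = size D + 2 then x else 0)"

lemma image_vec: "image_mset vec (mset_set {1..size D}) = D"
proof -
  let ?L = "rev (sorted_list_of_multiset D)"
  have "length ?L = size D" by (metis length_rev mset_sorted_list_of_multiset size_mset)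
  then have "image_mset vec (mset_set {1..size D}) = image_mset (\<lambda>i. ?L ! (i - 1)) (mset_set {1..length ?L})"
    unfolding \<open>length ?L = size D\<close> by (intro image_mset_cong) (auto simp: vec_def)
  also have "\<dots> = D" unfolding image_mset_nth_pred by simp
  finally show ?thesis .
qed

lemma vec_mem: "i \<in> {1..size D} \<Longrightarrow> vec i \<in># D"
proof -
  assume "i \<in> {1..size D}"
  then have "vec i \<in># image_mset vec (mset_set {1..size D})" by auto
  then show ?thesis by (simp only: image_vec)
qed

lemma vec_last: "vec (Suc (size D)) = u" "vec (Suc (Suc (size D))) = x"
  by (simp_all add: vec_def)

lemma vec_sum: "(\<Sum>i\<in>{1..Suc (size D)}. vec i) = n - x"
proof -
  have "(\<Sum>i\<in>{1..size D}. vec i) = sum_mset D"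
    by (simp only: sum_unfold_sum_mset image_vec)
  then show ?thesis using order by (simp add: vec_last)
qed

lemma vec_decr: "i \<in> {1..Suc (size D)} \<Longrightarrow> j \<in> {1..Suc (size D)} \<Longrightarrow> i \<le> j \<Longrightarrow> vec j \<le> vec i"
proof -
  assume ij: "i \<in> {1..Suc (size D)}" "j \<in> {1..Suc (size D)}" "i \<le> j"
  let ?L = "rev (sorted_list_of_multiset D)"
  have len: "length ?L = size D" by (metis length_rev mset_sorted_list_of_multiset size_mset)
  show "vec j \<le> vec i"
  proof (cases "j = Suc (size D)")
    case True
    then show ?thesis
      using vec_mem[of i] parts[of "vec i"] ij vec_last(1) by (cases "i = j") auto
  next
    case False
    then have "?L ! (j - 1) \<le> ?L ! (i - 1)"
      using ij len by (intro sorted_rev_nth_mono) auto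
    then show ?thesis using False ij by (simp add: vec_def)
  qed
qed

lemma vec_first: "vec 1 \<le> u + 1"
  using vec_mem[of 1] parts[of "vec 1"] vec_last(1) by (cases "size D = 0") auto

lemma vec_pos: "i \<in> {1..size D + 2} \<Longrightarrow> 1 \<le> vec i"
proof -
  assume "i \<in> {1..size D + 2}"
  then consider "i \<in> {1..size D}" | "i = Suc (size D)" | "i = size D + 2" by fastforce
  then show ?thesis
    by cases (use vec_mem parts small vec_last in fastforce)+
qed

lemma a_star_eq: "a_star n e = vec"
  unfolding a_star_def Let_def k_opt_eq last_part_eq
proof (rule the_equality)
  show "(\<forall>i\<in>{1..size D + 2}. 1 \<le> vec i) \<and> (\<forall>i. i \<notin> {1..size D + 2} \<longrightarrow> vec i = 0) \<and>
    vec (size D + 2) = x \<and> (\<Sum>i\<in>{1..size D + 2 - 1}. vec i) = n - vec (size D + 2) \<and>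
    (\<forall>i\<in>{1..size D + 2 - 1}. \<forall>j\<in>{1..size D + 2 - 1}. i \<le> j \<longrightarrow> vec j \<le> vec i) \<and>
    int (vec 1) - 1 \<le> int (vec (size D + 2 - 1))"
    using vec_pos vec_sum vec_decr vec_first vec_last by (auto simp: vec_def[of "_::nat"])
next
  fix a
  assume a: "(\<forall>i\<in>{1..size D + 2}. 1 \<le> a i) \<and> (\<forall>i. i \<notin> {1..size D + 2} \<longrightarrow> a i = 0) \<and>
    a (size D + 2) = x \<and> (\<Sum>i\<in>{1..size D + 2 - 1}. a i) = n - a (size D + 2) \<and>
    (\<forall>i\<in>{1..size D + 2 - 1}. \<forall>j\<in>{1..size D + 2 - 1}. i \<le> j \<longrightarrow> a j \<le> a i) \<and>
    int (a 1) - 1 \<le> int (a (size D + 2 - 1))"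
  show "a = vec"
  proof
    fix i
    consider "i \<in> {1..Suc (size D)}" | "i = size D + 2" | "i \<notin> {1..size D + 2}" by fastforce
    then show "a i = vec i"
    proof cases
      case 1
      then have "a i = (n - x) div Suc (size D) + (if i \<le> (n - x) mod Suc (size D) then 1 else 0)"
        using a by (intro balanced_vector_unique) auto
      also have "\<dots> = vec i"
        using vec_decr vec_sum vec_first vec_last 1 by (intro balanced_vector_unique[symmetric]) auto
      finally show ?thesis .
    next
      case 2
      then show ?thesis using a vec_last by simp
    next
      case 3
      then have "vec i = 0" by (auto simp: vec_def)
      then show ?thesis using a 3 by simp
    qed
  qed
qed

lemma image_vec_all: "image_mset vec (mset_set {1..size D + 2}) = D + {#u, x#}"
proof -
  have "{1..size D + 2} = insert (size D + 2) (insert (Suc (size D)) {1..size D})" by auto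
  then show ?thesis by (simp add: image_vec vec_last del: One_nat_def)
qed

lemma m_star_eq: "m_star n e = int m"
  unfolding m_star_def k_opt_eq a_star_eq sum_prods_eq_coeff image_vec_all edges_count by simp

text \<open>In \<open>1 + (u + x) t + (u x - m) t\<^sup>2\<close> the term
  \<open>- m t\<^sup>2\<close> multiplies the coefficient of degree \<open>r - 2\<close> of the
  first \<open>k - 2\<close> parts, which is the correction subtracted in
  \<open>h_star\<close>.\<close>

lemma h_star_eq:
  assumes "2 \<le> r"
  shows "h_star r n e = int (coeff (cfg_poly D (u + x) (u * x - m)) r)"
proof -
  obtain t where r: "r = 2 + t" using le_Suc_ex[OF assms] by blast
  then have r': "r = Suc (Suc t)" by simp
  have "m \<le> u * x" using frame_mult[OF frame] by simp
  then obtain f where f: "u * x = f + m" by (metis add.commute le_Suc_ex)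
  show ?thesis
    unfolding h_star_def m_star_eq k_opt_eq a_star_eq sum_prods_eq_coeff image_vec_all
      cfg_poly_product[symmetric] f
    by (simp add: image_vec r' coeff_cfg_poly_add2 algebra_simps del: One_nat_def)
qed

end

text \<open>Whichever canonical configuration a descent reaches, its parameters compute the same
  \<open>a_star\<close> and \<open>m_star\<close>, since those depend on \<open>n\<close> and
  \<open>e\<close> only.\<close>

lemma canonical_star_config:
  assumes can: "canonical c b f D u x m"
    and n: "coeff (cfg_poly c b f) 1 = n" and e: "coeff (cfg_poly c b f) 2 = e"
  shows "star_config D u x m n e"
proof
  show fr: "frame D u x m" using can by (simp add: canonical_def)
  show "sum_mset D + u + x = n"
    using n unfolding canonical_poly[OF can] by (simp add: coeff_cfg_poly_1)
  show "coeff (parts_poly (D + {#u, x#})) 2 = e + m"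
    using e frame_mult[OF fr] unfolding canonical_poly[OF can] cfg_poly_product[symmetric] coeff_cfg_poly_2
    by simp
qed

text \<open>Descent on the triangle count ends in a canonical configuration, whose counts are
  \<open>h_star\<close>. For a non-canonical one, equality would sandwich the count of its
  improvement, and an improvement that preserves the count at \<open>r\<close> forces that count to
  be 0.\<close>

lemma h_star_le:
  assumes "0 \<notin># c" "4 * f \<le> b\<^sup>2" "coeff (cfg_poly c b f) 1 = n" "coeff (cfg_poly c b f) 2 = e"
    "1 \<le> e" "3 \<le> r"
  shows "h_star r n e \<le> int (coeff (cfg_poly c b f) r) \<and>
    (h_star r n e = int (coeff (cfg_poly c b f) r) \<longrightarrow>
       coeff (cfg_poly c b f) r = 0 \<or> (\<exists>D u x m. canonical c b f D u x m))"
  using assms(1-4)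
proof (induction "coeff (cfg_poly c b f) 3" arbitrary: c b f rule: less_induct)
  case less
  show ?case
  proof (cases "\<exists>D u x m. canonical c b f D u x m")
    case True
    then obtain D u x m where can: "canonical c b f D u x m" by blast
    then interpret star_config D u x m n e using less.prems by (intro canonical_star_config)
    show ?thesis using True assms(6) by (simp add: h_star_eq canonical_poly[OF can])
  next
    case False
    have "coeff (cfg_poly c b f) 2 \<noteq> 0" using less.prems(4) assms(5) by simp
    then have "improvable (cfg_poly c b f)"
      using canonical_or_improvable[OF less.prems(1,2)] False by blast
    then obtain c' b' f' where *: "0 \<notin># c'" "4 * f' \<le> b'\<^sup>2"
      and imp: "improves (cfg_poly c' b' f') (cfg_poly c b f)" by (auto simp: improvable_def)
    then have "h_star r n e \<le> int (coeff (cfg_poly c' b' f') r)"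
      using less.hyps[of c' b' f'] less.prems by (auto simp: improves_def)
    then show ?thesis using imp assms(6) by (force simp: improves_def)
  qed
qed

lemma star_config_exists:
  assumes "1 \<le> e" "e \<le> n choose 2"
  shows "\<exists>D u x m. star_config D u x m n e"
proof -
  define P where "P Q \<longleftrightarrow> (\<exists>c b f. Q = cfg_poly c b f \<and> 0 \<notin># c \<and> 4 * f \<le> b\<^sup>2 \<and> coeff Q 1 = n \<and> coeff Q 2 = e)" for Q
  have "\<exists>Q. P Q" using configuration_exists[OF assms(2)] unfolding P_def by blast
  then obtain Q where Q: "P Q" and min: "\<And>R. P R \<Longrightarrow> coeff Q 3 \<le> coeff R 3"
    using ex_has_least_nat[of P _ "\<lambda>Q. coeff Q 3"] by blast
  then obtain c b f where cfg: "Q = cfg_poly c b f" "0 \<notin># c" "4 * f \<le> b\<^sup>2" "coeff Q 1 = n" "coeff Q 2 = e"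
    by (auto simp: P_def)
  have "\<not> improvable Q"
  proof
    assume "improvable Q"
    then obtain c' b' f' where "0 \<notin># c'" "4 * f' \<le> b'\<^sup>2" "improves (cfg_poly c' b' f') Q"
      by (auto simp: improvable_def)
    then show False using min[of "cfg_poly c' b' f'"] cfg(4,5) by (force simp: P_def improves_def)
  qed
  then obtain D u x m where "canonical c b f D u x m"
    using canonical_or_improvable[of c f b] cfg assms(1) by auto
  then show ?thesis using canonical_star_config cfg by blast
qed

subsection \<open>Mantel's theorem with its extremal graphs\<close>

lemma triangle_free_iff:
  "triangle_free (V, F) \<longleftrightarrow>
     (\<forall>x\<in>V. \<forall>y\<in>V. \<forall>z\<in>V. x \<noteq> y \<longrightarrow> x \<noteq> z \<longrightarrow> y \<noteq> z \<longrightarrow> \<not> ({x, y} \<in> F \<and> {x, z} \<in> F \<and> {y, z} \<in> F))"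
  (is "_ \<longleftrightarrow> ?no_triangle")
proof
  assume free: "triangle_free (V, F)"
  show ?no_triangle
  proof (intro ballI impI notI)
    fix x y z
    assume *: "x \<in> V" "y \<in> V" "z \<in> V" "x \<noteq> y" "x \<noteq> z" "y \<noteq> z" "{x, y} \<in> F \<and> {x, z} \<in> F \<and> {y, z} \<in> F"
    then have "{x, y, z} \<in> [V]\<^bsup>3\<^esup>" by (auto simp: nsets_def)
    moreover have "clique {x, y, z} F" using * by (auto simp: clique_def insert_commute)
    ultimately show False using free by (auto simp: triangle_free_def verts_def edges_def)
  qed
next
  assume none: ?no_triangle
  show "triangle_free (V, F)"
    unfolding triangle_free_def
  proof
    assume "\<exists>S\<in>[verts (V, F)]\<^bsup>3\<^esup>. clique S (edges (V, F))"
    then obtain x y z where "x \<in> V" "y \<in> V - {x}" "z \<in> V - {x, y}" "clique {x, y, z} F"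
      by (auto simp: nsets_3_eq verts_def edges_def)
    then show False using none by (auto simp: clique_def)
  qed
qed

lemma filter_mset_pos: "0 \<notin># (M :: nat multiset) \<Longrightarrow> filter_mset ((<) 0) M = M"
  by (induction M) auto

definition bipartite_edges :: "'a set \<Rightarrow> 'a set \<Rightarrow> 'a set set" where
  "bipartite_edges P Q = {{x, y} | x y. x \<in> P \<and> y \<in> Q}"

lemma card_bipartite_edges:
  assumes "finite P" "finite Q" "P \<inter> Q = {}"
  shows "finite (bipartite_edges P Q)" "card (bipartite_edges P Q) = card P * card Q"
proof -
  have eq: "bipartite_edges P Q = (\<lambda>(x, y). {x, y}) ` (P \<times> Q)"
    by (auto simp: bipartite_edges_def)
  have "inj_on (\<lambda>(x, y). {x, y}) (P \<times> Q)"
    using assms(3) by (auto simp: inj_on_def doubleton_eq_iff)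
  then show "finite (bipartite_edges P Q)" "card (bipartite_edges P Q) = card P * card Q"
    unfolding eq using assms by (simp_all add: card_image card_cartesian_product)
qed

lemma bipartite_edges_subset_nsets: "P \<inter> Q = {} \<Longrightarrow> bipartite_edges P Q \<subseteq> [P \<union> Q]\<^bsup>2\<^esup>"
  by (auto simp: bipartite_edges_def)

lemma triangle_free_bipartite:
  assumes "P \<inter> Q = {}" "F \<subseteq> bipartite_edges P Q"
  shows "triangle_free (P \<union> Q, F)"
proof -
  have "x \<in> P \<longleftrightarrow> y \<in> Q" "x \<in> Q \<longleftrightarrow> y \<in> P" if "{x, y} \<in> F" for x y
    using subsetD[OF assms(2) that] assms(1) by (auto simp: bipartite_edges_def doubleton_eq_iff)
  then show ?thesis unfolding triangle_free_iff using assms(1) by blast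
qed

text \<open>
  In a triangle-free graph the neighbourhood \<open>P\<close> of a vertex of maximum degree is independent, so
  every edge meets \<open>V - P\<close>, and it is counted twice if it lies inside \<open>V - P\<close>.
\<close>

lemma mantel_partition:
  assumes G: "fin_graph (V, F)" "triangle_free (V, F)"
  shows "\<exists>P\<subseteq>V. card F \<le> card P * card (V - P) \<and>
    (card F = card P * card (V - P) \<longrightarrow> F = bipartite_edges P (V - P))"
proof (cases "V = {}")
  case True
  then have "F = {}" using G(1) by (simp add: fin_graph_def verts_def edges_def nsets_2_eq)
  then show ?thesis using True by (simp add: bipartite_edges_def)
next
  case False
  have fin: "finite V" and F: "F \<subseteq> [V]\<^bsup>2\<^esup>" using G(1) by (auto simp: fin_graph_def verts_def edges_def)
  define nbs where "nbs v = {y \<in> V. {v, y} \<in> F}" for v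
  define deg where "deg v = card (nbs v)" for v
  have "Max (deg ` V) \<in> deg ` V" using fin False by (intro Max_in) auto
  then obtain v where v: "v \<in> V" "deg v = Max (deg ` V)" by auto
  have deg_le: "deg w \<le> deg v" if "w \<in> V" for w using that fin v(2) by simp
  define P where "P = nbs v"
  have "P \<subseteq> V" by (auto simp: P_def nbs_def)
  have finP: "finite P" "finite (V - P)" using fin by (auto simp: P_def nbs_def)
  have edge: "x \<in> V \<and> y \<in> V \<and> x \<noteq> y" if "{x, y} \<in> F" for x y
    using subsetD[OF F that] by simp
  have indep: "{x, y} \<notin> F" if "x \<in> P" "y \<in> P" for x y
    using that edge G(2) v(1) unfolding P_def nbs_def triangle_free_iff by blast
  define E where "E w = (\<lambda>y. {w, y}) ` nbs w" for w
  have finE: "finite (E w)" for w using fin by (simp add: E_def nbs_def)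
  have card_E: "card (E w) \<le> card P" if "w \<in> V" for w
  proof -
    have "card (E w) \<le> deg w" unfolding E_def deg_def using fin by (intro card_image_le) (simp add: nbs_def)
    then show ?thesis using deg_le[OF that] by (simp add: deg_def P_def)
  qed
  have F_eq: "d \<in> F \<Longrightarrow> \<exists>x y. d = {x, y} \<and> x \<in> V - P \<and> {x, y} \<in> F" for d
  proof -
    assume d: "d \<in> F"
    then obtain x y where xy: "d = {x, y}" "x \<in> V" "y \<in> V" using F by (auto elim!: nsets2_E)
    show ?thesis
    proof (cases "x \<in> P")
      case True
      then have "y \<in> V - P" using indep d xy by auto
      then show ?thesis using d xy by (metis insert_commute)
    qed (use d xy in auto)
  qed
  have E_mem: "{x, y} \<in> E x" if "{x, y} \<in> F" for x y
    using that edge by (auto simp: E_def nbs_def)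
  show ?thesis
  proof (cases "\<exists>x y. {x, y} \<in> F \<and> x \<in> V - P \<and> y \<in> V - P")
    case True
    then obtain x y where xy: "{x, y} \<in> F" "x \<in> V - P" "y \<in> V - P" by blast
    \<comment> \<open>The inner edge \<open>{x, y}\<close> is already covered by \<open>E y\<close>,
      so it may be removed from \<open>E x\<close>; this one edge makes the bound strict.\<close>
    have "F \<subseteq> (\<Union>w\<in>V - P - {x}. E w) \<union> (E x - {{x, y}})"
    proof
      fix d assume "d \<in> F"
      then obtain x' y' where d: "d = {x', y'}" "x' \<in> V - P" "{x', y'} \<in> F" using F_eq by blast
      show "d \<in> (\<Union>w\<in>V - P - {x}. E w) \<union> (E x - {{x, y}})"
      proof (cases "d = {x, y}")
        case True
        then have "d \<in> E y" using E_mem[of y x] xy(1) by (simp add: insert_commute)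
        then show ?thesis using xy edge[OF xy(1)] by blast
      next
        case False
        then show ?thesis using E_mem[OF d(3)] d by blast
      qed
    qed
    then have "card F \<le> card ((\<Union>w\<in>V - P - {x}. E w) \<union> (E x - {{x, y}}))"
      using finE finP by (intro card_mono) auto
    also have "\<dots> \<le> card (\<Union>w\<in>V - P - {x}. E w) + card (E x - {{x, y}})" by (rule card_Un_le)
    also have "card (\<Union>w\<in>V - P - {x}. E w) \<le> (\<Sum>w\<in>V - P - {x}. card (E w))"
      using finP by (intro card_UN_le) auto
    also have "\<dots> \<le> (\<Sum>w\<in>V - P - {x}. card P)" using card_E by (intro sum_mono) auto
    also have "\<dots> = (card (V - P) - 1) * card P" using xy(2) finP by simp
    also have "card (E x - {{x, y}}) = card (E x) - 1" using E_mem[OF xy(1)] by simp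
    finally have le: "card F \<le> (card (V - P) - 1) * card P + (card (E x) - 1)" by simp
    have "0 < card (E x)" using E_mem[OF xy(1)] finE card_gt_0_iff by blast
    moreover have "0 < card (V - P)" using xy(2) finP card_gt_0_iff by blast
    then obtain k where k: "card (V - P) = Suc k" by (cases "card (V - P)") auto
    ultimately have "card F < card P * card (V - P)"
      using le card_E[of x] xy(2) by (simp add: k mult.commute)
    then show ?thesis using \<open>P \<subseteq> V\<close> by (intro exI[of _ P]) simp
  next
    case False
    have "F \<subseteq> bipartite_edges P (V - P)"
    proof
      fix d assume "d \<in> F"
      then obtain x y where d: "d = {x, y}" "x \<in> V - P" "{x, y} \<in> F" using F_eq by blast
      then have "y \<in> P" using False edge by blast
      then show "d \<in> bipartite_edges P (V - P)"
        using d unfolding bipartite_edges_def by (blast intro: insert_commute)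
    qed
    moreover have "P \<inter> (V - P) = {}" by blast
    note bip = card_bipartite_edges[OF finP this]
    ultimately have "card F \<le> card P * card (V - P)"
      "card F = card P * card (V - P) \<Longrightarrow> F = bipartite_edges P (V - P)"
      using card_mono[OF bip(1)] card_subset_eq[OF bip(1)] unfolding bip(2) by auto
    then show ?thesis using \<open>P \<subseteq> V\<close> by blast
  qed
qed

lemma card_diff_add: "finite V \<Longrightarrow> P \<subseteq> V \<Longrightarrow> card P + card (V - P) = card V"
  by (metis Diff_disjoint Un_Diff_cancel card_Un_disjoint finite_Diff finite_subset sup.absorb2)

lemma mantel:
  assumes "fin_graph (V, F)" "triangle_free (V, F)"
  shows "4 * card F \<le> (card V)\<^sup>2"
proof -
  obtain P where P: "P \<subseteq> V" "card F \<le> card P * card (V - P)"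
    using mantel_partition[OF assms] by blast
  have "finite V" using assms(1) by (simp add: fin_graph_def verts_def)
  define s t where "s = card P" and "t = card (V - P)"
  have "4 * (int s * t) \<le> (int s + t)\<^sup>2"
    using zero_le_power2[of "int s - t"] by (simp add: power2_eq_square algebra_simps)
  then have "int (4 * (s * t)) \<le> int ((s + t)\<^sup>2)" by simp
  then have "4 * (s * t) \<le> (s + t)\<^sup>2" by (simp only: of_nat_le_iff)
  then show ?thesis using P card_diff_add[OF \<open>finite V\<close> P(1)] by (simp add: s_def t_def)
qed

lemma near_equal_factors_maximal:
  fixes p q s t :: nat
  assumes "s + t = p + q" "p * q \<le> s * t" "p \<le> q + 1" "q \<le> p + 1"
  shows "s = p \<and> t = q \<or> s = q \<and> t = p"
proof -
  have "(int s - t)\<^sup>2 = (int s + t)\<^sup>2 - 4 * (int s * t)"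
    by (simp add: power2_eq_square algebra_simps)
  also have "\<dots> \<le> (int p + q)\<^sup>2 - 4 * (int p * q)"
    using assms(1,2) by (metis diff_left_mono mult_le_cancel_left_pos of_nat_add of_nat_mono of_nat_mult zero_less_numeral)
  also have "\<dots> = (int p - q)\<^sup>2"
    by (simp add: power2_eq_square algebra_simps)
  finally have "\<bar>int s - t\<bar> \<le> \<bar>int p - q\<bar>" by (simp add: abs_le_square_iff)
  then show ?thesis using assms by linarith
qed

text \<open>Nearly equal \<open>p\<close>, \<open>q\<close> maximise the product for their sum, so
  the sides of the partition must have these sizes and every cross edge is present. For unequal
  sides this fails: order 4 and size 3 admit a star and a path. If one side is empty, there are no
  edges.\<close>

lemma mantel_extremal:
  assumes G: "fin_graph (V, F)" "triangle_free (V, F)"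
    and pq: "card V = p + q" "card F = p * q" "p = 0 \<or> q = 0 \<or> p \<le> q + 1 \<and> q \<le> p + 1"
  shows "\<exists>P\<subseteq>V. {#card P, card (V - P)#} = {#p, q#} \<and> F = bipartite_edges P (V - P)"
proof (cases "p = 0 \<or> q = 0")
  case True
  have "finite F" using G(1) finite_imp_finite_nsets[of V 2]
    by (auto simp: fin_graph_def verts_def edges_def intro: finite_subset)
  then have "F = {}" using True pq(2) by auto
  then show ?thesis using True pq(1)
    by (intro exI[of _ V]) (auto simp: bipartite_edges_def add_mset_commute)
next
  case False
  obtain P where P: "P \<subseteq> V" "card F \<le> card P * card (V - P)"
    "card F = card P * card (V - P) \<Longrightarrow> F = bipartite_edges P (V - P)"
    using mantel_partition[OF G] by blast
  have "finite V" using G(1) by (simp add: fin_graph_def verts_def)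
  then have "card P = p \<and> card (V - P) = q \<or> card P = q \<and> card (V - P) = p"
    using P pq False card_diff_add[of V P] by (intro near_equal_factors_maximal) auto
  then show ?thesis using P pq(2)
    by (intro exI[of _ P]) (auto simp: add_mset_commute mult.commute)
qed

section \<open>Reindexing and regrouping the parts of a join\<close>

lemma join_graph_cong:
  assumes "bij_betw h I J" "\<And>i. i \<in> I \<Longrightarrow> A i = B (h i)"
  shows "join_graph I A W F = join_graph J B W F"
    and "joinable I A W F \<longleftrightarrow> joinable J B W F"
    and "card_mset I A = card_mset J B"
proof -
  have J: "J = h ` I" and inj: "inj_on h I" using assms(1) by (auto simp: bij_betw_def)
  have "(\<exists>i\<in>J. \<exists>j\<in>J. i \<noteq> j \<and> x \<in> B i \<and> y \<in> B j) \<longleftrightarrow> (\<exists>i\<in>I. \<exists>j\<in>I. i \<noteq> j \<and> x \<in> A i \<and> y \<in> A j)" for x y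
    using inj unfolding J by (auto simp: assms(2) inj_on_eq_iff)
  moreover have "(\<exists>j\<in>J. y \<in> B j) \<longleftrightarrow> (\<exists>i\<in>I. y \<in> A i)" for y
    unfolding J by (auto simp: assms(2))
  moreover have "(\<Union>j\<in>J. B j) = (\<Union>i\<in>I. A i)" unfolding J using assms(2) by auto
  ultimately show "join_graph I A W F = join_graph J B W F" by (simp add: join_graph_def)
  have "disjoint_family_on A I \<longleftrightarrow> disjoint_family_on B J"
    using inj unfolding J by (auto simp: disjoint_family_on_def assms(2) inj_on_eq_iff)
  moreover have "finite I \<longleftrightarrow> finite J" using assms(1) by (rule bij_betw_finite)
  ultimately show "joinable I A W F \<longleftrightarrow> joinable J B W F"
    unfolding joinable_def J by (simp add: assms(2))
  show "card_mset I A = card_mset J B"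
    unfolding J image_mset_mset_set[OF inj, symmetric] image_mset.compositionality
    by (intro image_mset_cong, cases "finite I") (simp_all add: assms(2))
qed

text \<open>Turns an equality of multisets of part sizes into a renumbering of the parts: align the
  index sets by any bijection, then correct it by a permutation.\<close>

lemma card_mset_match:
  fixes I J :: "nat set"
  assumes "finite I" "finite J" "image_mset a (mset_set I) = card_mset J B"
  shows "\<exists>h. bij_betw h I J \<and> (\<forall>i\<in>I. card (B (h i)) = a i)"
proof -
  have "card I = card J" using assms(3) by (metis size_image_mset size_mset_set)
  then obtain g where g: "bij_betw g I J" using finite_same_card_bij assms(1,2) by blast
  have eq: "image_mset a (mset_set I) = card_mset I (\<lambda>i. B (g i))"
    using join_graph_cong(3)[OF g, of "\<lambda>i. B (g i)" B] assms(3) by simp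
  obtain p where p: "p permutes I" "\<forall>i\<in>I. a i = card (B (g (p i)))"
    by (rule image_mset_eq_implies_permutes[OF assms(1) eq])
  have "bij_betw (g \<circ> p) I J" using g permutes_imp_bij[OF p(1)] by (rule bij_betw_trans[rotated])
  then show ?thesis using p(2) by (intro exI[of _ "g \<circ> p"]) simp
qed

lemma join_graph_insert:
  assumes "i \<notin> J"
  shows "join_graph (insert i J) B {} {} = join_graph J B (B i) {}"
proof -
  have "{{x, y} | x y. \<exists>a\<in>insert i J. \<exists>b\<in>insert i J. a \<noteq> b \<and> x \<in> B a \<and> y \<in> B b} =
      {{x, y} | x y. \<exists>a\<in>J. \<exists>b\<in>J. a \<noteq> b \<and> x \<in> B a \<and> y \<in> B b} \<union> {{x, y} | x y. x \<in> B i \<and> (\<exists>j\<in>J. y \<in> B j)}"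
    (is "?L = ?R")
  proof
    show "?L \<subseteq> ?R"
    proof
      fix d assume "d \<in> ?L"
      then obtain x y a b where d: "d = {x, y}" "a \<in> insert i J" "b \<in> insert i J" "a \<noteq> b" "x \<in> B a" "y \<in> B b"
        by blast
      consider "a \<in> J" "b \<in> J" | "a = i" "b \<in> J" | "b = i" "a \<in> J" using d by blast
      then show "d \<in> ?R"
      proof cases
        case 3
        have "d = {y, x}" using d(1) by auto
        then show ?thesis using d 3 by blast
      qed (use d in blast)+
    qed
    show "?R \<subseteq> ?L"
    proof
      fix d assume "d \<in> ?R"
      then consider "d \<in> {{x, y} | x y. \<exists>a\<in>J. \<exists>b\<in>J. a \<noteq> b \<and> x \<in> B a \<and> y \<in> B b}"
        | "d \<in> {{x, y} | x y. x \<in> B i \<and> (\<exists>j\<in>J. y \<in> B j)}"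
        by (rule UnE)
      then show "d \<in> ?L"
      proof cases
        case 2
        then obtain x y j where xy: "d = {x, y}" "x \<in> B i" "j \<in> J" "y \<in> B j" by blast
        moreover have "i \<noteq> j" "i \<in> insert i J" "j \<in> insert i J" using xy assms by auto
        ultimately show ?thesis by blast
      qed blast
    qed
  qed
  then show ?thesis by (simp add: join_graph_def)
qed

text \<open>Two independent parts are read as one special part carrying a complete bipartite graph;
  this is the graph side of \<open>cfg_poly_product\<close>.\<close>

lemma join_graph_insert_insert:
  assumes "i \<notin> J" "j \<notin> J" "i \<noteq> j"
  shows "join_graph (insert i (insert j J)) B {} {} = join_graph J B (B i \<union> B j) (bipartite_edges (B i) (B j))"
proof -
  have "join_graph (insert j J) B (B i) {} = join_graph J B (B i \<union> B j) (bipartite_edges (B i) (B j))"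
  proof -
    have "snd (join_graph (insert j J) B {} {}) = snd (join_graph J B (B j) {})"
      using join_graph_insert[OF assms(2)] by metis
    then have "{{x, y} | x y. \<exists>a\<in>insert j J. \<exists>b\<in>insert j J. a \<noteq> b \<and> x \<in> B a \<and> y \<in> B b} =
      {{x, y} | x y. \<exists>a\<in>J. \<exists>b\<in>J. a \<noteq> b \<and> x \<in> B a \<and> y \<in> B b} \<union> {{x, y} | x y. x \<in> B j \<and> (\<exists>k\<in>J. y \<in> B k)}"
      by (simp add: join_graph_def)
    moreover have "{{x, y} | x y. x \<in> B i \<and> (\<exists>k\<in>insert j J. y \<in> B k)} =
       bipartite_edges (B i) (B j) \<union> {{x, y} | x y. x \<in> B i \<and> (\<exists>k\<in>J. y \<in> B k)}"
      unfolding bipartite_edges_def by blast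
    moreover have "{{x, y} | x y. x \<in> B i \<union> B j \<and> (\<exists>k\<in>J. y \<in> B k)} =
      {{x, y} | x y. x \<in> B i \<and> (\<exists>k\<in>J. y \<in> B k)} \<union> {{x, y} | x y. x \<in> B j \<and> (\<exists>k\<in>J. y \<in> B k)}"
      by blast
    ultimately show ?thesis unfolding join_graph_def by (simp add: Un_ac)
  qed
  then show ?thesis using join_graph_insert[of i "insert j J" B] assms by simp
qed

lemma joinable_independentI:
  "finite J \<Longrightarrow> (\<And>j. j \<in> J \<Longrightarrow> finite (B j)) \<Longrightarrow> disjoint_family_on B J \<Longrightarrow> joinable J B {} {}"
  by (simp add: joinable_def fin_graph_def verts_def edges_def triangle_free_empty)

lemma replace_induced_join_graph:
  assumes "\<And>j. j \<in> J \<Longrightarrow> U \<inter> B j = {}" "F \<subseteq> [U]\<^bsup>2\<^esup>"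
  shows "replace_induced (join_graph J B U F) U F' = join_graph J B U F'"
proof -
  have outside: "x \<notin> U" if "x \<in> B j" "j \<in> J" for x j
    using that assms(1) by blast
  have "{{x, y} | x y. \<exists>i\<in>J. \<exists>j\<in>J. i \<noteq> j \<and> x \<in> B i \<and> y \<in> B j} \<inter> [U]\<^bsup>2\<^esup> = {}"
    "{{x, y} | x y. x \<in> U \<and> (\<exists>j\<in>J. y \<in> B j)} \<inter> [U]\<^bsup>2\<^esup> = {}"
    by (auto dest: outside)
  note disj = this
  have "X \<inter> N = {} \<Longrightarrow> Y \<inter> N = {} \<Longrightarrow> F \<subseteq> N \<Longrightarrow> X \<union> Y \<union> F - N \<union> F' = X \<union> Y \<union> F'" for X Y N
    by blast
  from this[OF disj assms(2)] show ?thesis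
    by (simp add: replace_induced_def join_graph_def verts_def edges_def)
qed

subsection \<open>The two families as joins\<close>

lemma K_family_iff:
  "G \<in> K_family n e \<longleftrightarrow> ne_graph n e G \<and>
     (\<exists>J B W F. joinable J B W F \<and> (\<forall>j\<in>J. B j \<noteq> {}) \<and> W \<noteq> {} \<and> G = join_graph J B W F)"
proof (intro iffI conjI)
  assume "G \<in> K_family n e"
  then obtain l A i F where *: "disjoint_parts l A" "\<forall>j\<in>{1..l}. A j \<noteq> {}" "i \<in> {1..l}"
    "fin_graph (A i, F)" "triangle_free (A i, F)" "verts G = verts (multipartite l A)"
    "edges G = edges (multipartite l A) \<union> F" and "ne_graph n e G"
    unfolding K_family_def by blast
  then show "ne_graph n e G" by blast
  define J where "J = {1..l} - {i}"
  have J: "{1..l} = insert i J" "i \<notin> J" using *(3) by (auto simp: J_def)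
  have M: "multipartite l A = join_graph J A (A i) {}"
    unfolding multipartite_eq_join_graph J(1) using J(2) by (rule join_graph_insert)
  have "G = (verts G, edges G)" by (simp add: verts_def edges_def)
  also have "\<dots> = join_graph J A (A i) F"
    unfolding *(6,7) M by (simp add: join_graph_def verts_def edges_def)
  finally have "G = join_graph J A (A i) F" .
  moreover have "A i \<inter> A j = {}" if "j \<in> J" for j
    using *(1,3) that unfolding disjoint_parts_def disjoint_family_on_def J_def by blast
  then have "joinable J A (A i) F"
    using *(1,4,5) unfolding joinable_def disjoint_parts_def J_def
    by (auto simp: disjoint_family_on_def)
  ultimately show "\<exists>J B W F. joinable J B W F \<and> (\<forall>j\<in>J. B j \<noteq> {}) \<and> W \<noteq> {} \<and> G = join_graph J B W F"
    using *(2) J by blast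
next
  assume G: "ne_graph n e G \<and>
     (\<exists>J B W F. joinable J B W F \<and> (\<forall>j\<in>J. B j \<noteq> {}) \<and> W \<noteq> {} \<and> G = join_graph J B W F)"
  then obtain J B W F where J: "joinable J B W F" "\<forall>j\<in>J. B j \<noteq> {}" "W \<noteq> {}" "G = join_graph J B W F" by blast
  then obtain h where h: "bij_betw h {1..card J} J"
    using ex_bij_betw_nat_finite_1[of J] by (auto simp: joinable_def)
  define l where "l = Suc (card J)"
  define A where "A i = (if i \<in> {1..card J} then B (h i) else W)" for i
  have A: "A i = B (h i)" if "i \<in> {1..card J}" for i using that by (simp add: A_def)
  have Al: "A l = W" by (simp add: A_def l_def)
  have l: "{1..l} = insert l {1..card J}" "l \<notin> {1..card J}" by (auto simp: l_def)
  have G': "G = join_graph {1..card J} A W F" and join: "joinable {1..card J} A W F"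
    using join_graph_cong(1)[OF h, of A B W F, OF A] join_graph_cong(2)[OF h, of A B W F, OF A] J by simp_all
  have M: "multipartite l A = join_graph {1..card J} A W {}"
    unfolding multipartite_eq_join_graph l(1) Al[symmetric] using l(2) by (rule join_graph_insert)
  have fin: "fin_graph (W, F)" using J(1) by (simp add: joinable_def)
  have "disjoint_parts l A"
    unfolding disjoint_parts_def
  proof (intro conjI ballI)
    show "finite (A i)" if "i \<in> {1..l}" for i
      using that join fin Al l by (auto simp: joinable_def fin_graph_def verts_def)
    show "disjoint_family_on A {1..l}"
      using join Al unfolding l(1) disjoint_family_on_def joinable_def by blast
  qed
  moreover have "A j \<noteq> {}" if "j \<in> {1..l}" for j
  proof (cases "j = l")
    case False
    then have "j \<in> {1..card J}" using that l(1) by blast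
    moreover from this have "h j \<in> J" by (rule bij_betw_apply[OF h])
    ultimately show ?thesis using A J(2) by metis
  qed (use Al J(3) in simp)
  moreover have "verts G = verts (multipartite l A)" "edges G = edges (multipartite l A) \<union> F"
    unfolding G' M by (simp_all add: join_graph_def verts_def edges_def)
  moreover have "1 \<le> l" "l \<in> {1..l}" by (simp_all add: l_def)
  ultimately show "G \<in> K_family n e"
    unfolding K_family_def using G J(1) Al by (auto simp: joinable_def intro!: exI[of _ l] exI[of _ A] exI[of _ F])
qed

section \<open>The extremal family in join form\<close>

context star_config
begin

text \<open>\<open>W\<close> plays the union of the \<open>i\<close>-th and the last part of
  \<open>T\<close>, and \<open>J\<close> lists the others. Only sizes are prescribed, because the
  graph on \<open>W\<close> replaces whatever \<open>T\<close> had there.\<close>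

definition star_join :: "nat set \<Rightarrow> (nat \<Rightarrow> 'a set) \<Rightarrow> 'a set \<Rightarrow> 'a set set \<Rightarrow> nat \<Rightarrow> bool" where
  "star_join J B W F i \<longleftrightarrow> joinable J B W F \<and> i \<in> {1..Suc (size D)} \<and> (m = 0 \<or> i = Suc (size D)) \<and>
     card_mset J B = image_mset vec (mset_set ({1..Suc (size D)} - {i})) \<and>
     card W = vec i + x \<and> card F + m = vec i * x"

lemma parts_without_eq:
  assumes "i \<in> {1..Suc (size D)}"
  shows "add_mset (vec i) (image_mset vec (mset_set ({1..Suc (size D)} - {i}))) = add_mset u D"
proof -
  have "add_mset (vec i) (image_mset vec (mset_set ({1..Suc (size D)} - {i}))) =
      image_mset vec (mset_set (insert i ({1..Suc (size D)} - {i})))"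
    by (simp del: insert_Diff_single insert_Diff)
  also have "insert i ({1..Suc (size D)} - {i}) = insert (Suc (size D)) {1..size D}"
    using assms by auto
  also have "image_mset vec (mset_set (insert (Suc (size D)) {1..size D})) = add_mset u D"
    using image_vec by (simp add: vec_last del: One_nat_def)
  finally show ?thesis .
qed

lemma star_join_poly:
  assumes "star_join J B W F i"
  shows "cfg_poly (card_mset J B) (card W) (card F) = cfg_poly D (u + x) (u * x - m)"
proof -
  have i: "i \<in> {1..Suc (size D)}" "m = 0 \<or> i = Suc (size D)"
    and c: "card_mset J B = image_mset vec (mset_set ({1..Suc (size D)} - {i}))"
    "card W = vec i + x" "card F + m = vec i * x"
    using assms by (auto simp: star_join_def)
  have add: "add_mset (vec i) (card_mset J B) = add_mset u D"
    unfolding c(1) using i(1) by (rule parts_without_eq)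
  show ?thesis
  proof (cases "i = Suc (size D)")
    case True
    then have "vec i = u" by (simp add: vec_last)
    then have "card_mset J B = D" using add by simp
    then show ?thesis using c \<open>vec i = u\<close> by (metis add_diff_cancel_right')
  next
    case False
    \<comment> \<open>With \<open>m = 0\<close> the special factor splits as
      \<open>(1 + vec i t) (1 + x t)\<close>, so the role of \<open>vec i\<close> can be passed to
      \<open>u\<close>.\<close>
    then have "m = 0" using i by blast
    then have "cfg_poly (card_mset J B) (card W) (card F) = parts_poly (add_mset x (add_mset (vec i) (card_mset J B)))"
      using c(2,3) by (simp only: add_0_right cfg_poly_product union_mset_add_mset_right add_mset_commute add.right_neutral)
    also have "\<dots> = cfg_poly D (u + x) (u * x - m)"
      unfolding add \<open>m = 0\<close> diff_zero cfg_poly_product by (simp only: union_mset_add_mset_right add_mset_commute add.right_neutral)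
    finally show ?thesis .
  qed
qed

lemma star_join_H1_star:
  assumes "star_join J B W F i"
  shows "join_graph J B W F \<in> H1_star n e"
proof -
  have J: "joinable J B W F" and i: "i \<in> {1..Suc (size D)}" "m = 0 \<or> i = Suc (size D)"
    and c: "image_mset vec (mset_set ({1..Suc (size D)} - {i})) = card_mset J B"
    "card W = vec i + x" "card F + m = vec i * x"
    using assms by (auto simp: star_join_def)
  define k where "k = size D + 2"
  define I where "I = {1..Suc (size D)} - {i}"
  have finJ: "finite J" and W: "fin_graph (W, F)" "triangle_free (W, F)" using J by (auto simp: joinable_def)
  have finW: "finite W" and FW: "F \<subseteq> [W]\<^bsup>2\<^esup>" using W(1) by (auto simp: fin_graph_def verts_def edges_def)
  obtain h where h: "bij_betw h I J" "\<forall>j\<in>I. card (B (h j)) = vec j"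
    using card_mset_match[OF _ finJ c(1)] by (auto simp: I_def)
  \<comment> \<open>Any cut of \<open>W\<close> into the right sizes will do: \<open>F\<close> need
    not respect it, as the bipartite graph between the two pieces is replaced.\<close>
  obtain P where P: "P \<subseteq> W" "card P = vec i" using c(2) obtain_subset_with_card_n[of "vec i" W] by auto
  have Q: "card (W - P) = x" using card_diff_add[OF finW P(1)] P(2) c(2) by simp
  define A where "A j = (if j = i then P else if j = k then W - P else B (h j))" for j
  have ik: "i \<noteq> k" "i \<notin> I" "k \<notin> I" "{1..k} = insert i (insert k I)" using i by (auto simp: k_def I_def)
  have A: "A j = B (h j)" if "j \<in> I" for j using that ik by (auto simp: A_def)
  have Ai: "A i = P" "A k = W - P" "A i \<union> A k = W" using ik P(1) by (auto simp: A_def)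
  have JA: "joinable I A W F" and G: "join_graph I A W F = join_graph J B W F"
    using join_graph_cong(1)[OF h(1), of A B W F, OF A] join_graph_cong(2)[OF h(1), of A B W F, OF A] J
    by simp_all
  have M: "multipartite k A = join_graph I A W (bipartite_edges P (W - P))"
    unfolding multipartite_eq_join_graph ik(4)
    using join_graph_insert_insert[OF ik(2,3,1), of A] unfolding Ai(3) unfolding Ai(1,2) .
  have "disjoint_parts k A"
    unfolding disjoint_parts_def ik(4)
  proof (intro conjI ballI)
    show "finite (A j)" if "j \<in> insert i (insert k I)" for j
      using that JA finW P Ai by (auto simp: joinable_def intro: finite_subset)
    have "A j \<inter> W = {}" if "j \<in> I" for j using that JA by (auto simp: joinable_def)
    moreover have "A a \<inter> A b = {}" if "a \<in> I" "b \<in> I" "a \<noteq> b" for a b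
      using that JA by (simp add: joinable_def disjoint_family_on_def)
    moreover have "A i \<inter> A k = {}" "A k \<inter> A i = {}" "A i \<subseteq> W" "A k \<subseteq> W" using Ai P(1) by auto
    ultimately show "disjoint_family_on A (insert i (insert k I))"
      unfolding disjoint_family_on_def by (intro ballI impI) (elim insertE; blast)
  qed
  moreover have "card (A j) = vec j" if "j \<in> {1..k}" for j
    using that h(2) A P(2) Q Ai vec_last(2) unfolding ik(4) by (auto simp: k_def)
  moreover have "join_graph J B W F = replace_induced (multipartite k A) (A i \<union> A k) F"
    unfolding M Ai(3) G[symmetric]
    using JA bipartite_edges_subset_nsets[of P "W - P"] P(1)
    by (intro replace_induced_join_graph[symmetric]) (auto simp: joinable_def Un_absorb1)
  moreover have "int (card F) = int (vec i * vec k) - int m"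
    using c(3) vec_last(2) by (simp add: k_def flip: c(3))
  moreover have "i \<in> (if int m = 0 then {1..k - 1} else {k - 1})"
    using i by (auto simp: k_def)
  ultimately show ?thesis
    unfolding H1_star_def Let_def k_opt_eq a_star_eq m_star_eq k_def[symmetric]
    using W Ai(3) by (intro CollectI exI[of _ A] exI[of _ i] exI[of _ F]) simp
qed

lemma H1_star_join:
  assumes "G \<in> H1_star n e"
  shows "\<exists>J B W F i. star_join J B W F i \<and> (\<forall>j\<in>J. B j \<noteq> {}) \<and> W \<noteq> {} \<and> G = join_graph J B W F"
proof -
  define k where "k = size D + 2"
  obtain A i F where *: "disjoint_parts k A" "\<And>j. j \<in> {1..k} \<Longrightarrow> card (A j) = vec j"
    "i \<in> (if int m = 0 then {1..k - 1} else {k - 1})" "fin_graph (A i \<union> A k, F)"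
    "triangle_free (A i \<union> A k, F)" "int (card F) = int (vec i * vec k) - int m"
    "G = replace_induced (multipartite k A) (A i \<union> A k) F"
    using assms unfolding H1_star_def Let_def k_opt_eq a_star_eq m_star_eq k_def[symmetric] by blast
  have i: "i \<in> {1..Suc (size D)}" "m = 0 \<or> i = Suc (size D)"
    using *(3) by (auto simp: k_def split: if_splits)
  define I where "I = {1..Suc (size D)} - {i}"
  have ik: "i \<noteq> k" "i \<notin> I" "k \<notin> I" "{1..k} = insert i (insert k I)" using i by (auto simp: k_def I_def)
  have fin: "finite (A j)" if "j \<in> insert i (insert k I)" for j
    using *(1) that unfolding disjoint_parts_def ik(4) by blast
  have disj: "A a \<inter> A b = {}" if "a \<in> insert i (insert k I)" "b \<in> insert i (insert k I)" "a \<noteq> b" for a b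
    using *(1) that unfolding disjoint_parts_def disjoint_family_on_def ik(4) by blast
  have cards: "card (A j) = vec j" if "j \<in> insert i (insert k I)" for j
    using *(2) that unfolding ik(4) by blast
  have vk: "vec k = x" using vec_last(2) by (simp add: k_def)
  have M: "multipartite k A = join_graph I A (A i \<union> A k) (bipartite_edges (A i) (A k))"
    unfolding multipartite_eq_join_graph ik(4) by (rule join_graph_insert_insert[OF ik(2,3,1)])
  have disjI: "(A i \<union> A k) \<inter> A j = {}" if "j \<in> I" for j
  proof -
    have "i \<noteq> j" "k \<noteq> j" using that ik(2,3) by auto
    then have "A i \<inter> A j = {}" "A k \<inter> A j = {}" using that disj[of i j] disj[of k j] by blast+
    then show ?thesis by blast
  qed
  have G: "G = join_graph I A (A i \<union> A k) F"
    unfolding *(7) M using disjI bipartite_edges_subset_nsets[of "A i" "A k"] disj[of i k] ik(1)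
    by (intro replace_induced_join_graph) simp_all
  have nonempty: "A j \<noteq> {}" if "j \<in> insert i (insert k I)" for j
  proof -
    have "j \<in> {1..k}" using that unfolding ik(4) .
    then have "j \<in> {1..size D + 2}" by (simp only: k_def)
    then show ?thesis using cards[OF that] vec_pos[of j] by auto
  qed
  have "joinable I A (A i \<union> A k) F"
    unfolding joinable_def disjoint_family_on_def
  proof (intro conjI ballI impI)
    show "finite I" by (simp add: I_def)
    show "A a \<inter> A b = {}" if "a \<in> I" "b \<in> I" "a \<noteq> b" for a b using disj that by blast
  qed (use fin disjI *(4,5) in simp_all)
  moreover have "card_mset I A = image_mset vec (mset_set ({1..Suc (size D)} - {i}))"
    unfolding I_def[symmetric] using cards by (intro image_mset_cong) (auto simp: I_def)
  moreover have "card (A i \<union> A k) = vec i + x"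
    using cards[of i] cards[of k] fin[of i] fin[of k] disj[of i k] ik(1) vk by (simp add: card_Un_disjoint)
  moreover have "card F + m = vec i * x" using *(6) unfolding vk by linarith
  ultimately have "star_join I A (A i \<union> A k) F i" using i by (simp add: star_join_def)
  moreover have "\<forall>j\<in>I. A j \<noteq> {}" "A i \<union> A k \<noteq> {}" using nonempty by auto
  ultimately show ?thesis
    using G by (intro exI[of _ I] exI[of _ A] exI[of _ "A i \<union> A k"] exI[of _ F] exI[of _ i] conjI)
qed

lemma star_join_exists: "\<exists>J (B :: nat \<Rightarrow> nat set) W F i. star_join J B W F i"
proof -
  \<comment> \<open>Coding pairs \<open>(j, t)\<close> as numbers yields disjoint blocks of the
    prescribed sizes inside \<open>nat\<close>.\<close>
  define A where "A j = (\<lambda>t. prod_encode (j, t)) ` {..<vec j}" for j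
  have cardA: "card (A j) = vec j" for j
    unfolding A_def by (simp add: card_image inj_on_def)
  have disj: "A a \<inter> A b = {}" if "a \<noteq> b" for a b using that by (auto simp: A_def)
  define P Q where "P = A (Suc (size D))" and "Q = A (size D + 2)"
  have finA: "finite (A j)" for j by (simp add: A_def)
  have PQ: "finite P" "finite Q" "P \<inter> Q = {}" "card P = u" "card Q = x"
    using disj cardA vec_last finA by (auto simp: P_def Q_def)
  have "u * x - m \<le> card (bipartite_edges P Q)" using card_bipartite_edges[OF PQ(1-3)] PQ(4,5) by simp
  then obtain F where F: "F \<subseteq> bipartite_edges P Q" "card F = u * x - m"
    using obtain_subset_with_card_n by metis
  have "fin_graph (P \<union> Q, F)"
    using F(1) bipartite_edges_subset_nsets[OF PQ(3)] PQ by (auto simp: fin_graph_def verts_def edges_def)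
  moreover have "triangle_free (P \<union> Q, F)" using triangle_free_bipartite PQ(3) F(1) by blast
  ultimately have "joinable {1..size D} A (P \<union> Q) F"
    unfolding joinable_def disjoint_family_on_def
  proof (intro conjI ballI impI)
    fix j assume "j \<in> {1..size D}"
    then have "P \<inter> A j = {}" "Q \<inter> A j = {}" unfolding P_def Q_def by (auto intro!: disj simp del: disjoint_iff)
    then show "(P \<union> Q) \<inter> A j = {}" by blast
  qed (use disj finA in simp_all)
  moreover have "card F + m = u * x" using F(2) frame_mult[OF frame] by simp
  moreover have "{1..Suc (size D)} - {Suc (size D)} = {1..size D}" by auto
  moreover have "card (P \<union> Q) = u + x" using PQ by (simp add: card_Un_disjoint)
  ultimately have "star_join {1..size D} A (P \<union> Q) F (Suc (size D))"
    unfolding star_join_def using cardA vec_last by simp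
  then show ?thesis by blast
qed

text \<open>In the multipartite reading, if the special part accounts for the last part
  \<open>x\<close> and another part, any triangle-free graph on it is allowed by
  \<open>H1_star\<close>. Otherwise the nonzero sizes among \<open>p\<close>, \<open>q\<close>
  belong to the larger, nearly equal parts unless one of \<open>p\<close>, \<open>q\<close> is 0;
  Mantel's uniqueness then makes the graph equal to \<open>T\<close>, which is read again with its
  last two parts merged.\<close>

lemma canonical_H1_star:
  assumes J: "joinable J B W F" "\<And>j. j \<in> J \<Longrightarrow> B j \<noteq> {}"
    and can: "canonical (card_mset J B) (card W) (card F) D u x m"
  shows "join_graph J B W F \<in> H1_star n e"
proof -
  have W: "fin_graph (W, F)" "triangle_free (W, F)" and finJ: "finite J" using J(1) by (auto simp: joinable_def)
  have finB: "finite (B j)" if "j \<in> J" for j using that J(1) by (auto simp: joinable_def)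
  have finW: "finite W" using W(1) by (auto simp: fin_graph_def verts_def)
  have last: "{1..Suc (size D)} - {Suc (size D)} = {1..size D}" by auto
  from can consider
      "card_mset J B = D" "card W = u + x" "card F + m = u * x"
    | p q where "m = 0" "card W = p + q" "card F = p * q"
        "filter_mset ((<) 0) (card_mset J B + {#p, q#}) = D + {#u, x#}"
    unfolding canonical_def by blast
  then show ?thesis
  proof cases
    case 1
    then have "star_join J B W F (Suc (size D))"
      using J(1) vec_last(1) image_vec last by (simp add: star_join_def)
    then show ?thesis by (rule star_join_H1_star)
  next
    case 2
    have cards_pos: "0 \<notin># card_mset J B" using J(2) finB finJ by auto
    then have filter: "filter_mset ((<) 0) (card_mset J B) = card_mset J B"
      by (rule filter_mset_pos)
    show ?thesis
    \<comment> \<open>Requiring \<open>0 < p'\<close> excludes an independent \<open>W\<close> of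
      size \<open>x\<close> read as \<open>x + 0\<close>, since an empty part is no part of
      \<open>T\<close> to merge with the last one.\<close>
    proof (cases "\<exists>p'. 0 < p' \<and> {#p, q#} = {#p', x#}")
      case True
      then obtain p' where p': "0 < p'" "{#p, q#} = {#p', x#}" by blast
      then have pq: "p + q = p' + x" "p * q = p' * x"
        by (auto simp: add_eq_conv_ex)
      have "card_mset J B + {#p', x#} = D + {#u, x#}"
        using 2(4) filter p' small(1) by simp
      then have c: "add_mset p' (card_mset J B) = add_mset u D" by simp
      then have "p' \<in># add_mset u D" by (metis union_single_eq_member)
      also have "add_mset u D = image_mset vec (mset_set (insert (Suc (size D)) {1..size D}))"
        using image_vec by (simp add: vec_last del: One_nat_def)
      finally obtain i where i: "i \<in> {1..Suc (size D)}" "vec i = p'" by fastforce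
      have "card_mset J B = image_mset vec (mset_set ({1..Suc (size D)} - {i}))"
        using parts_without_eq[OF i(1)] c i(2) by (metis add_mset_add_mset_same_iff)
      then have "star_join J B W F i"
        unfolding star_join_def using i J(1) 2(1-3) pq by simp
      then show ?thesis by (rule star_join_H1_star)
    next
      case False
      then have no_x: "0 < p' \<Longrightarrow> {#p, q#} \<noteq> {#p', x#}" for p' by blast
      have "p = 0 \<or> q = 0 \<or> p \<le> q + 1 \<and> q \<le> p + 1"
      proof (cases "p = 0 \<or> q = 0")
        case False
        then have "card_mset J B + {#p, q#} = D + {#u, x#}" using 2(4) filter by simp
        moreover have "p \<in># card_mset J B + {#p, q#}" "q \<in># card_mset J B + {#p, q#}" by simp_all
        ultimately have "p \<in># D + {#u, x#}" "q \<in># D + {#u, x#}" by (simp_all only:)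
        moreover have "p \<noteq> x"
        proof
          assume "p = x"
          then have "{#p, q#} = {#q, x#}" by simp
          with no_x[of q] False show False by simp
        qed
        moreover have "q \<noteq> x"
        proof
          assume "q = x"
          with no_x[of p] False show False by simp
        qed
        ultimately have "p = u \<or> p \<in># D" "q = u \<or> q \<in># D" by simp_all
        then have "p = u \<or> p = u + 1" "q = u \<or> q = u + 1" using parts[of p] parts[of q] by blast+
        then show ?thesis by auto
      qed blast
      then obtain P where P: "P \<subseteq> W" "{#card P, card (W - P)#} = {#p, q#}" "F = bipartite_edges P (W - P)"
        using mantel_extremal[OF W 2(2,3)] by blast
      obtain a where a: "a \<notin> J" using finJ ex_new_if_finite infinite_UNIV_nat by blast
      obtain b where b: "b \<notin> insert a J" using finJ ex_new_if_finite infinite_UNIV_nat by (metis finite_insert)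
      define B' where "B' = B(a := P, b := W - P)"
      define J' where "J' = insert a (insert b J)"
      \<comment> \<open>One of the pieces \<open>P\<close>, \<open>W - P\<close> may be empty,
        whereas all parts of \<open>T\<close> are nonempty; dropping empty pieces makes the sizes
        comparable.\<close>
      define J'' where "J'' = {j \<in> J'. B' j \<noteq> {}}"
      have B': "B' a = P" "B' b = W - P" "\<And>j. j \<in> J \<Longrightarrow> B' j = B j" using a b by (auto simp: B'_def)
      have WP: "P \<union> (W - P) = W" using P(1) by blast
      have "join_graph J' B' {} {} = join_graph J B' W F"
        unfolding J'_def using join_graph_insert_insert[of a J b B'] a b unfolding B' WP P(3)[symmetric] by auto
      also have "\<dots> = join_graph J B W F"
        using B'(3) by (intro join_graph_cong(1)[of id]) auto
      finally have G: "join_graph J B W F = join_graph J' B' {} {}" ..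
      also have "\<dots> = join_graph J'' B' {} {}"
        unfolding J''_def join_graph_def by (intro prod_eqI) (auto, metis empty_iff)
      finally have G: "join_graph J B W F = join_graph J'' B' {} {}" .
      have fin': "finite J'" "finite J''" "\<And>j. j \<in> J' \<Longrightarrow> finite (B' j)"
        using finJ finB finW P(1) B' by (auto simp: J'_def J''_def intro: finite_subset)
      have "disjoint_family_on B' J'"
        using J(1) B' P(1) a b unfolding J'_def joinable_def disjoint_family_on_def by auto blast+
      then have disj: "disjoint_family_on B' J''" by (auto simp: disjoint_family_on_def J''_def)
      have "J'' = {j \<in> J'. 0 < card (B' j)}" using fin'(3) by (auto simp: J''_def card_gt_0_iff)
      then have "card_mset J'' B' = filter_mset ((<) 0) (card_mset J' B')"
        by (simp add: filter_mset_image_mset fin'(1))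
      also have "card_mset J' B' = card_mset J B' + {#card P, card (W - P)#}"
        using a b finJ B' by (auto simp: J'_def)
      also have "card_mset J B' = card_mset J B" using B'(3) finJ by (intro image_mset_cong) auto
      finally have "card_mset J'' B' = D + {#u, x#}" using 2(4) P(2) by simp
      then have "image_mset vec (mset_set {1..size D + 2}) = card_mset J'' B'" by (simp only: image_vec_all)
      then obtain h where h: "bij_betw h {1..size D + 2} J''" "\<forall>i\<in>{1..size D + 2}. card (B' (h i)) = vec i"
        using card_mset_match fin'(2) by (metis finite_atLeastAtMost)
      define A where "A = B' \<circ> h"
      define k where "k = size D + 2"
      have "join_graph J B W F = join_graph {1..k} A {} {}"
        unfolding G using join_graph_cong(1)[OF h(1), of A B'] by (simp add: A_def k_def)
      also have "{1..k} = insert (Suc (size D)) (insert k {1..size D})" by (auto simp: k_def)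
      also have "join_graph \<dots> A {} {} = join_graph {1..size D} A (A (Suc (size D)) \<union> A k)
          (bipartite_edges (A (Suc (size D))) (A k))"
        by (intro join_graph_insert_insert) (auto simp: k_def)
      finally have G': "join_graph J B W F = join_graph {1..size D} A (A (Suc (size D)) \<union> A k)
          (bipartite_edges (A (Suc (size D))) (A k))" .
      have "joinable {1..k} A {} {}"
        using join_graph_cong(2)[OF h(1), of A B'] joinable_independentI[OF fin'(2) _ disj] fin'(3)
        by (simp add: A_def k_def J''_def)
      then have A: "\<And>i. i \<in> {1..k} \<Longrightarrow> finite (A i)" "disjoint_family_on A {1..k}"
        by (auto simp: joinable_def)
      have cardA: "card (A i) = vec i" if "i \<in> {1..k}" for i using h(2) that by (simp add: A_def k_def)
      define U V where "U = A (Suc (size D))" and "V = A k"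
      have UV: "finite U" "finite V" "U \<inter> V = {}" "card U = u" "card V = x"
        using A cardA vec_last by (auto simp: U_def V_def k_def disjoint_family_on_def)
      have "joinable {1..size D} A (U \<union> V) (bipartite_edges U V)"
        unfolding joinable_def
      proof (intro conjI ballI)
        show "fin_graph (U \<union> V, bipartite_edges U V)"
          using bipartite_edges_subset_nsets UV by (auto simp: fin_graph_def verts_def edges_def)
        show "triangle_free (U \<union> V, bipartite_edges U V)"
          using triangle_free_bipartite UV(3) by blast
        show "(U \<union> V) \<inter> A j = {}" if "j \<in> {1..size D}" for j
        proof -
          have "U \<inter> A j = {}" "V \<inter> A j = {}"
            using A(2) that unfolding disjoint_family_on_def U_def V_def k_def
            by (simp_all del: disjoint_iff)
          then show ?thesis by blast
        qed
      qed (use A in \<open>auto simp: disjoint_family_on_def k_def\<close>)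
      moreover have "card_mset {1..size D} A = image_mset vec (mset_set {1..size D})"
        using cardA by (intro image_mset_cong) (auto simp: k_def)
      moreover have "card (U \<union> V) = u + x" using UV by (simp add: card_Un_disjoint)
      moreover have "card (bipartite_edges U V) = u * x" using UV card_bipartite_edges by metis
      ultimately have "star_join {1..size D} A (U \<union> V) (bipartite_edges U V) (Suc (size D))"
        unfolding star_join_def using \<open>m = 0\<close> vec_last(1) last by simp
      then show ?thesis unfolding G' U_def V_def by (rule star_join_H1_star)
    qed
  qed
qed

end

theorem theorem1p1:
  fixes r n e :: nat
  assumes "3 \<le> r" and "r \<le> n" and "1 \<le> e" and "e \<le> n choose 2"
  shows "((\<exists>G \<in> (K_family n e :: nat graph set). int (num_cliques r G) = h_star r n e) \<and>
          (\<forall>G \<in> (K_family n e :: nat graph set). h_star r n e \<le> int (num_cliques r G))) \<and>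
         (4 \<le> r \<and> turan_num (r - 1) n < e \<longrightarrow>
          {G \<in> (K_family n e :: nat graph set). int (num_cliques r G) = h_star r n e} = H1_star n e)"
proof -
  obtain D u x m where star: "star_config D u x m n e"
    using star_config_exists[OF assms(3,4)] by blast
  interpret star_config D u x m n e by (rule star)
  have n_e: "coeff (cfg_poly D (u + x) (u * x - m)) 1 = n" "coeff (cfg_poly D (u + x) (u * x - m)) 2 = e"
  proof -
    show "coeff (cfg_poly D (u + x) (u * x - m)) 1 = n" using order by (simp add: coeff_cfg_poly_1)
    show "coeff (cfg_poly D (u + x) (u * x - m)) 2 = e"
      using edges_count frame_mult[OF frame]
      unfolding cfg_poly_product[symmetric] coeff_cfg_poly_2 by simp
  qed
  have H1: "G \<in> K_family n e \<and> int (num_cliques r G) = h_star r n e" if G: "G \<in> H1_star n e" for G :: "nat graph"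
  proof -
    obtain J B W F i where J: "star_join J B W F i" "\<forall>j\<in>J. B j \<noteq> {}" "W \<noteq> {}" "G = join_graph J B W F"
      using H1_star_join[OF G] by blast
    then have "joinable J B W F" by (simp add: star_join_def)
    moreover from this have "ne_graph n e G" "num_cliques r G = coeff (cfg_poly D (u + x) (u * x - m)) r"
      using n_e star_join_poly[OF J(1)] unfolding J(4) by (simp_all add: ne_graph_join_graph num_cliques_join_graph)
    ultimately have "G \<in> K_family n e" unfolding K_family_iff using J by blast
    then show ?thesis
      using h_star_eq[of r] assms(1) \<open>num_cliques r G = coeff (cfg_poly D (u + x) (u * x - m)) r\<close> by simp
  qed
  have K: "h_star r n e \<le> int (num_cliques r G) \<and>
      (h_star r n e = int (num_cliques r G) \<and> num_cliques r G \<noteq> 0 \<longrightarrow> G \<in> H1_star n e)"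
    if GK: "G \<in> K_family n e" for G :: "nat graph"
  proof -
    obtain J B W F where J: "joinable J B W F" "\<forall>j\<in>J. B j \<noteq> {}" "G = join_graph J B W F"
      and ne: "ne_graph n e G"
      using GK unfolding K_family_iff by blast
    have fin: "finite J" "\<And>j. j \<in> J \<Longrightarrow> finite (B j)" "fin_graph (W, F)" "triangle_free (W, F)"
      using J(1) by (auto simp: joinable_def)
    let ?c = "card_mset J B" and ?b = "card W" and ?f = "card F"
    have poly: "coeff (cfg_poly ?c ?b ?f) 1 = n" "coeff (cfg_poly ?c ?b ?f) 2 = e"
      "num_cliques r G = coeff (cfg_poly ?c ?b ?f) r"
      using ne J(1) unfolding J(3) by (simp_all add: ne_graph_join_graph num_cliques_join_graph)
    have pos: "0 \<notin># ?c" using fin J(2) by auto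
    have H1: "G \<in> H1_star n e" if can: "canonical ?c ?b ?f D' u' x' m'" for D' u' x' m'
    proof -
      \<comment> \<open>The parameters found for \<open>G\<close> may a priori differ from those
        fixed above, but \<open>H1_star n e\<close> mentions neither, so membership transfers
        directly.\<close>
      interpret S: star_config D' u' x' m' n e using can poly(1,2) by (rule canonical_star_config)
      show ?thesis unfolding J(3) using J(1,2) can by (intro S.canonical_H1_star) auto
    qed
    note le = h_star_le[OF pos mantel[OF fin(3,4)] poly(1,2) assms(3,1), folded poly(3)]
    show ?thesis
    proof (intro conjI impI)
      assume "h_star r n e = int (num_cliques r G) \<and> num_cliques r G \<noteq> 0"
      then obtain D' u' x' m' where "canonical ?c ?b ?f D' u' x' m'" using le by auto
      then show "G \<in> H1_star n e" by (rule H1)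
    qed (use le in blast)
  qed
  obtain J B W F i where "star_join J (B :: nat \<Rightarrow> nat set) W F i" using star_join_exists by blast
  then have "join_graph J B W F \<in> H1_star n e" by (rule star_join_H1_star)
  then have attained: "\<exists>G \<in> (K_family n e :: nat graph set). int (num_cliques r G) = h_star r n e"
    using H1 by blast
  have "{G \<in> (K_family n e :: nat graph set). int (num_cliques r G) = h_star r n e} = H1_star n e"
    if "4 \<le> r" "turan_num (r - 1) n < e"
  proof -
    \<comment> \<open>More than \<open>t_{r-1}(n)\<close> edges force at least \<open>r\<close>
      parts. An edge of the special part together with one vertex from each of \<open>r - 2\<close>
      parts in \<open>D\<close> is then an \<open>r\<close>-clique, so the minimum is positive and
      equality characterises the graph.\<close>
    have "r - 2 \<le> size D"
    proof (rule ccontr)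
      assume "\<not> r - 2 \<le> size D"
      then have "size D + 2 \<le> r - 1" by simp
      then have "e \<le> turan_sum (r - 1) n"
        using turan_sum_mono[of "size D + 2" "r - 1" n] edges_le_turan_sum by linarith
      moreover have "turan_num (r - 1) n = turan_sum (r - 1) n"
        using that by (intro turan_num_eq_turan_sum) simp
      ultimately show False using that by simp
    qed
    have "0 < u * x - m" using frame_mult[OF frame] by simp
    moreover have "u \<noteq> 0" using small by simp
    then have "0 \<notin># D" using parts by fastforce
    then have "0 < coeff (parts_poly D) (r - 2)" using \<open>r - 2 \<le> size D\<close> by (rule coeff_parts_poly_pos)
    ultimately have "0 < (u * x - m) * coeff (parts_poly D) (r - 2)" by simp
    moreover have "r = Suc (Suc (r - 2))" using that by simp
    ultimately have "0 < coeff (cfg_poly D (u + x) (u * x - m)) r"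
      by (metis coeff_cfg_poly_add2 add_gr_0)
    then have "h_star r n e \<noteq> 0" using assms(1) h_star_eq[of r] by simp
    then show ?thesis using H1 K by force
  qed
  then show ?thesis using attained K by blast
qed

end
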